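(* Let $Q$ be the cube graph. The pot $$P_1=\big\{\{1,1,1\},\{2,2,2\},\{-2,-3,-3\},\{-1,-4,-4\},\{-1,3,-5\},\{-2,4,5\}\big\}$$ (inner braces denoting multisets) is a biminimal pot that $3$-realizes the cube; that is, $P_1$ $3$-realizes $Q$, $|P_1|=T_3(Q)$ and $|\Sigma(P_1)|=B_3(Q)$.
   Context: Graphs are connected, have non-empty vertex set, and may have loops and multiple edges. Formally a graph is a triple $(V(G),E(G),\mu)$ with $\mu$ assigning to each edge an unordered pair of (not necessarily distinct) vertices (undirected graph) or an ordered pair of vertices (directed graph). An orientation $\vec G$ of an undirected graph $G$ is a directed graph obtained by choosing a direction for every edge of $G$. The cube $Q$ is the simple undirected graph with vertex set $\mathbb{Z}_2^3$ in which $x,y$ are adjacent iff $x-y\in\{100,010,001\}$. An edge-coloring of a graph with $c$ colors is any map $\lambda$ from its edge set to $[1,c]=\{1,\dots,c\}$ (no properness required). A tile is a finite multiset of integers; a pot is a set of tiles. $\Sigma(P)$ is the set of positive integers (colors) appearing in some tile of the pot $P$. For an edge-coloring $\lambda$ of a directed graph $D$ and a vertex $x$, the tile $\tau_x(\lambda)$ is the multiset containing one copy of $\lambda(e)$ for each non-loop edge $e$ with tail $x$ (i.e. $e=(x,y)$, $y\ne x$), one copy of $-\lambda(e)$ for each non-loop edge $e$ with head $x$ (i.e. $e=(y,x)$, $y\neq x$), and both $\lambda(e)$ and $-\lambda(e)$ for each loop $e$ at $x$. The pot induced by $\lambda$ is $\mathcal{P}(\lambda)=\{\tau_x(\lambda)\mid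 x\in V(D)\}$ (a set of distinct tiles). A pot $P$ realizes an undirected graph $G$, written $G\in\mathcal{O}(P)$, if there is an edge-coloring $\lambda$ of some orientation of $G$ with $\mathcal{P}(\lambda)\subseteq P$. $P$ $3$-realizes $G$ if $G\in\mathcal{O}(P)$ and there is no $H\in\mathcal{O}(P)$ with $H\not\simeq G$ and $|V(H)|\le|V(G)|$. $T_3(G)=\min\{|P| : P \text{ is a pot that 3-realizes } G\}$ and $B_3(G)=\min\{|\Sigma(P)| : P \text{ is a pot that 3-realizes } G\}$ (two independent minima). A pot $P$ that $3$-realizes $G$ is biminimal if $|P|=T_3(G)$ and $|\Sigma(P)|=B_3(G)$. *)

theory Defs
  imports
    "HOL-Library.Multiset"
    "HOL-Library.Uprod"
    "HOL-Library.Z2"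
    "HOL-Library.Product_Plus"
    "Graph_Theory.Digraph"
begin

text \<open>
  Undirected graphs with loops and multiple edges: \<open>uends\<close> assigns to every edge the unordered
  pair of its (not necessarily distinct) ends. Directed graphs are those of
  \<^theory>\<open>Graph_Theory.Digraph\<close>.
\<close>

record ('v, 'e) ugraph_data =
  uverts :: "'v set"
  uedges :: "'e set"
  uends :: "'e \<Rightarrow> 'v uprod"

definition uadj :: "('v, 'e) ugraph_data \<Rightarrow> ('v \<times> 'v) set" where
  "uadj G = {(x, y). \<exists>e\<in>uedges G. uends G e = Upair x y}"

definition uconnected :: "('v, 'e) ugraph_data \<Rightarrow> bool" where
  "uconnected G \<longleftrightarrow> (\<forall>x\<in>uverts G. \<forall>y\<in>uverts G. (x, y) \<in> (uadj G)\<^sup>*)"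

text \<open>
  Finiteness of the edge set is part of the notion because the tiles below are finite multisets.
\<close>

definition ugraph :: "('v, 'e) ugraph_data \<Rightarrow> bool" where
  "ugraph G \<longleftrightarrow>
     uverts G \<noteq> {} \<and> finite (uverts G) \<and> finite (uedges G) \<and>
     (\<forall>e\<in>uedges G. set_uprod (uends G e) \<subseteq> uverts G) \<and>
     uconnected G"

definition ugraph_iso :: "('v, 'e) ugraph_data \<Rightarrow> ('w, 'f) ugraph_data \<Rightarrow> bool" where
  "ugraph_iso G H \<longleftrightarrow>
     (\<exists>f g. bij_betw f (uverts G) (uverts H) \<and> bij_betw g (uedges G) (uedges H) \<and>
            (\<forall>e\<in>uedges G. uends H (g e) = map_uprod f (uends G e)))"

definition is_orientation :: "('v, 'e) pre_digraph \<Rightarrow> ('v, 'e) ugraph_data \<Rightarrow> bool" where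
  "is_orientation D G \<longleftrightarrow>
     verts D = uverts G \<and> arcs D = uedges G \<and>
     (\<forall>e\<in>uedges G. Upair (tail D e) (head D e) = uends G e)"

definition cube :: "(bit \<times> bit \<times> bit, (bit \<times> bit \<times> bit) uprod) ugraph_data" where
  "cube =
     \<lparr> uverts = UNIV,
       uedges = {Upair x y | x y. x - y \<in> {(1, 0, 0), (0, 1, 0), (0, 0, 1)}},
       uends = (\<lambda>e. e) \<rparr>"

definition edge_coloring :: "nat \<Rightarrow> ('v, 'e) pre_digraph \<Rightarrow> ('e \<Rightarrow> int) \<Rightarrow> bool" where
  "edge_coloring c D l \<longleftrightarrow> (\<forall>e\<in>arcs D. l e \<in> {1..int c})"

type_synonym tile = "int multiset"
type_synonym pot = "tile set"

definition pot_colors :: "pot \<Rightarrow> int set" where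
  "pot_colors P = {k. k > 0 \<and> (\<exists>t\<in>P. k \<in># t)}"

text \<open>
  A loop at \<open>x\<close> lies both in \<open>out_arcs D x\<close> and in \<open>in_arcs D x\<close>, and so contributes its color
  with both signs.
\<close>

definition vertex_tile :: "('v, 'e) pre_digraph \<Rightarrow> ('e \<Rightarrow> int) \<Rightarrow> 'v \<Rightarrow> tile" where
  "vertex_tile D l x =
     image_mset l (mset_set (out_arcs D x)) +
     image_mset (\<lambda>e. - l e) (mset_set (in_arcs D x))"

definition induced_pot :: "('v, 'e) pre_digraph \<Rightarrow> ('e \<Rightarrow> int) \<Rightarrow> pot" where
  "induced_pot D l = vertex_tile D l ` verts D"

definition realizes :: "pot \<Rightarrow> ('v, 'e) ugraph_data \<Rightarrow> bool" where
  "realizes P G \<longleftrightarrow>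
     ugraph G \<and>
     (\<exists>D c l. is_orientation D G \<and> edge_coloring c D l \<and> induced_pot D l \<subseteq> P)"

text \<open>
  A definition cannot quantify over the types of the vertices and edges of \<open>H\<close>; since graphs are
  finite, every isomorphism class has a representative with vertices and edges in \<open>nat\<close>.
\<close>

definition realizes3 :: "pot \<Rightarrow> ('v, 'e) ugraph_data \<Rightarrow> bool" where
  "realizes3 P G \<longleftrightarrow>
     realizes P G \<and>
     \<not> (\<exists>H :: (nat, nat) ugraph_data.
          realizes P H \<and> \<not> ugraph_iso H G \<and> card (uverts H) \<le> card (uverts G))"

text \<open>
  The finiteness conditions are there because \<open>card\<close> is \<open>0\<close> on infinite sets. Both numbers are
  meaningful only for graphs that are 3-realized by some pot, in particular by a finite one.
\<close>

definition T3 :: "('v, 'e) ugraph_data \<Rightarrow> nat" where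
  "T3 G = (LEAST n. \<exists>P. realizes3 P G \<and> finite P \<and> card P = n)"

definition B3 :: "('v, 'e) ugraph_data \<Rightarrow> nat" where
  "B3 G = (LEAST n. \<exists>P. realizes3 P G \<and> finite (pot_colors P) \<and> card (pot_colors P) = n)"

definition biminimal :: "pot \<Rightarrow> ('v, 'e) ugraph_data \<Rightarrow> bool" where
  "biminimal P G \<longleftrightarrow>
     realizes3 P G \<and>
     finite P \<and> card P = T3 G \<and>
     finite (pot_colors P) \<and> card (pot_colors P) = B3 G"

end

theory Submission
  imports Defs "HOL-Combinatorics.Transposition"
begin

text \<open>
  Exchanging the heads of two arcs of the same color changes no tile, so if the pot 3-realizes the
  cube \<open>Q\<close>, then the result must again be \<open>Q\<close>. Viewing \<open>Q\<close> as the complete bipartite graph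
  \<open>K\<^sub>4\<^sub>,\<^sub>4\<close> minus a perfect matching, this forces any two disjoint arcs of the same color to be
  antipodal, with tails in the same parity class. Hence a color class is a star or an antipodal pair
  of edges.

  Four colors would therefore have to be the four stars centered at one parity class, and then the
  pot also realizes \<open>K\<^sub>3\<^sub>,\<^sub>3\<close>. No three vertices have the same tile, and if one parity
  class splits into two pairs of vertices with equal tiles, then the tiles of the other class are
  pairwise different; so there are at least six tiles.

  For the given pot, counting each color with both signs shows that the six tiles occur in the
  proportions 1:1:1:1:2:2, so that a realized graph has at least eight vertices; with exactly eight,
  the arcs are determined up to exchanging the last two vertices.
\<close>

section \<open>Realizable graphs\<close>

definition underlying :: "('v, 'e) pre_digraph \<Rightarrow> ('v, 'e) ugraph_data" where
  "underlying D =
     \<lparr>uverts = verts D, uedges = arcs D, uends = (\<lambda>e. Upair (tail D e) (head D e))\<rparr>"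

lemma underlying_simps [simp]:
  "uverts (underlying D) = verts D"
  "uedges (underlying D) = arcs D"
  "uends (underlying D) e = Upair (tail D e) (head D e)"
  by (simp_all add: underlying_def)

section \<open>Transport of realizations along isomorphisms\<close>

lemma ugraph_iso_trans:
  assumes "ugraph_iso G H" "ugraph_iso H K"
  shows "ugraph_iso G K"
proof -
  obtain f g where f: "bij_betw f (uverts G) (uverts H)" and g: "bij_betw g (uedges G) (uedges H)"
    and e: "\<And>e. e \<in> uedges G \<Longrightarrow> uends H (g e) = map_uprod f (uends G e)"
    using assms(1) unfolding ugraph_iso_def by blast
  obtain f' g' where f': "bij_betw f' (uverts H) (uverts K)"
    and g': "bij_betw g' (uedges H) (uedges K)"
    and e': "\<And>e. e \<in> uedges H \<Longrightarrow> uends K (g' e) = map_uprod f' (uends H e)"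
    using assms(2) unfolding ugraph_iso_def by blast
  have "uends K ((g' \<circ> g) e) = map_uprod (f' \<circ> f) (uends G e)" if "e \<in> uedges G" for e
    using that e[OF that] e'[of "g e"] bij_betwE[OF g]
    by (cases "uends G e" rule: uprod_exhaust) auto
  then show ?thesis
    unfolding ugraph_iso_def using bij_betw_trans[OF f f'] bij_betw_trans[OF g g'] by blast
qed

lemma ugraph_iso_card_verts: "ugraph_iso G H \<Longrightarrow> card (uverts G) = card (uverts H)"
  unfolding ugraph_iso_def using bij_betw_same_card by blast

lemma ugraph_iso_ugraph:
  assumes "ugraph G" "ugraph_iso G H"
  shows "ugraph H"
proof -
  obtain f g where f: "bij_betw f (uverts G) (uverts H)" and g: "bij_betw g (uedges G) (uedges H)"
    and e: "\<And>e. e \<in> uedges G \<Longrightarrow> uends H (g e) = map_uprod f (uends G e)"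
    using assms(2) unfolding ugraph_iso_def by blast
  have V: "uverts H = f ` uverts G" and E: "uedges H = g ` uedges G"
    using f g by (auto simp: bij_betw_def)
  have ends: "set_uprod (uends H e) \<subseteq> uverts H" if "e \<in> uedges H" for e
  proof -
    obtain d where d: "d \<in> uedges G" "e = g d" using \<open>e \<in> uedges H\<close> E by blast
    have "set_uprod (uends G d) \<subseteq> uverts G" using assms(1) d unfolding ugraph_def by blast
    then show ?thesis
      using e[OF d(1)] d V by (cases "uends G d" rule: uprod_exhaust) auto
  qed
  have step: "(f x, f y) \<in> uadj H" if xy: "(x, y) \<in> uadj G" for x y
  proof -
    obtain d where "d \<in> uedges G" "uends G d = Upair x y"
      using xy unfolding uadj_def by blast
    then show ?thesis using e[of d] E by (force simp: uadj_def)
  qed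
  have "(f x, f y) \<in> (uadj H)\<^sup>*" if "(x, y) \<in> (uadj G)\<^sup>*" for x y
    using that by (induction) (auto intro: step rtrancl_into_rtrancl)
  then have "uconnected H"
    using assms(1) unfolding uconnected_def ugraph_def V by blast
  with ends assms(1) show ?thesis
    unfolding ugraph_def V E by auto
qed

text \<open>Orientation and coloring are carried along the isomorphism edge by edge, and
  corresponding vertices keep their tiles.\<close>

lemma realizes_ugraph_iso:
  assumes "realizes P G" "ugraph_iso G H"
  shows "realizes P H"
proof -
  have G: "ugraph G" using assms(1) by (simp add: realizes_def)
  obtain f g where f: "bij_betw f (uverts G) (uverts H)" and g: "bij_betw g (uedges G) (uedges H)"
    and e: "\<And>e. e \<in> uedges G \<Longrightarrow> uends H (g e) = map_uprod f (uends G e)"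
    using assms(2) unfolding ugraph_iso_def by blast
  obtain D c l where D: "is_orientation D G" and c: "edge_coloring c D l"
    and P: "induced_pot D l \<subseteq> P"
    using assms(1) by (auto simp: realizes_def)
  define h where "h = inv_into (uedges G) g"
  define D' where "D' = \<lparr>verts = uverts H, arcs = uedges H,
    tail = f \<circ> tail D \<circ> h, head = f \<circ> head D \<circ> h\<rparr>"
  have V: "uverts H = f ` uverts G" and E: "uedges H = g ` uedges G"
    and inj: "inj_on f (uverts G)" "inj_on g (uedges G)"
    using f g by (auto simp: bij_betw_def)
  have h: "h (g d) = d" if "d \<in> uedges G" for d
    unfolding h_def using inj that by simp
  have D_simps: "verts D = uverts G" "arcs D = uedges G"
    "\<And>d. d \<in> uedges G \<Longrightarrow> uends G d = Upair (tail D d) (head D d)"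
    using D by (auto simp: is_orientation_def)
  have in_V: "tail D d \<in> uverts G" "head D d \<in> uverts G" if "d \<in> uedges G" for d
    using G D_simps(3)[OF that] that unfolding ugraph_def by force+
  have "is_orientation D' H"
    unfolding is_orientation_def D'_def E using h e D_simps(3) by auto
  moreover have "edge_coloring c D' (l \<circ> h)"
    using c h D_simps(2) unfolding edge_coloring_def D'_def E by auto
  moreover have "vertex_tile D' (l \<circ> h) (f x) = vertex_tile D l x" if "x \<in> uverts G" for x
  proof -
    have out: "out_arcs D' (f x) = g ` out_arcs D x"
      unfolding out_arcs_def D'_def D_simps(2) using h in_V inj_onD[OF inj(1)] that
      by (auto simp: E)
    have "in": "in_arcs D' (f x) = g ` in_arcs D x"
      unfolding in_arcs_def D'_def D_simps(2) using h in_V inj_onD[OF inj(1)] that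
      by (auto simp: E)
    have sub: "out_arcs D x \<subseteq> uedges G" "in_arcs D x \<subseteq> uedges G"
      using D_simps(2) by (auto simp: out_arcs_def in_arcs_def)
    have *: "image_mset k (mset_set (g ` S)) = image_mset (k \<circ> g) (mset_set S)"
      if "S \<subseteq> uedges G" for S and k :: "_ \<Rightarrow> int"
      by (metis image_mset_mset_set inj(2) inj_on_subset multiset.map_comp that)
    have "image_mset (k \<circ> h \<circ> g) (mset_set S) = image_mset k (mset_set S)"
      if "S \<subseteq> uedges G" for S and k :: "_ \<Rightarrow> int"
      using that h by (intro image_mset_cong) (metis comp_apply elem_mset_set infinite_set_mset_mset_set
          empty_iff subsetD)
    then have **: "image_mset (k \<circ> h) (mset_set (g ` S)) = image_mset k (mset_set S)"
      if "S \<subseteq> uedges G" for S and k :: "_ \<Rightarrow> int"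
      using *[OF that, of "k \<circ> h"] that by simp
    show ?thesis
      unfolding vertex_tile_def out "in"
      using **[OF sub(1), of l] **[OF sub(2), of "\<lambda>e. - l e"] by (simp add: comp_def)
  qed
  then have "induced_pot D' (l \<circ> h) \<subseteq> P"
    using P unfolding induced_pot_def D'_def V D_simps(1) by auto
  ultimately show ?thesis
    unfolding realizes_def using ugraph_iso_ugraph[OF G assms(2)] by blast
qed

text \<open>\<open>realizes3\<close> speaks only of competitors whose vertices and edges are natural
  numbers; through such a copy it applies to competitors over other types.\<close>

lemma ugraph_nat_copy:
  assumes "ugraph G"
  obtains H :: "(nat, nat) ugraph_data" where "ugraph_iso G H"
proof -
  have "finite (uverts G)" "finite (uedges G)" using assms by (auto simp: ugraph_def)
  then obtain f :: "_ \<Rightarrow> nat" and g :: "_ \<Rightarrow> nat"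
    where f: "inj_on f (uverts G)" and g: "inj_on g (uedges G)"
    using finite_imp_inj_to_nat_seg by metis
  have "ugraph_iso G \<lparr>uverts = f ` uverts G, uedges = g ` uedges G,
    uends = map_uprod f \<circ> uends G \<circ> inv_into (uedges G) g\<rparr>"
    unfolding ugraph_iso_def using f g
    by (intro exI[of _ f] exI[of _ g]) (auto simp: bij_betw_def)
  then show thesis by (rule that)
qed

lemma realizes3_iso:
  assumes "realizes3 P G" "realizes P H" "card (uverts H) \<le> card (uverts G)"
  shows "ugraph_iso H G"
proof -
  obtain K :: "(nat, nat) ugraph_data" where K: "ugraph_iso H K"
    using ugraph_nat_copy assms(2) unfolding realizes_def by metis
  then have "realizes P K" using assms(2) realizes_ugraph_iso by blast
  moreover have "card (uverts K) \<le> card (uverts G)"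
    using assms(3) ugraph_iso_card_verts[OF K] by simp
  ultimately have "ugraph_iso K G" using assms(1) unfolding realizes3_def by blast
  then show ?thesis using K ugraph_iso_trans by blast
qed

section \<open>Colored digraphs as competitors\<close>

lemma edge_coloring_exists:
  assumes "finite (arcs D)" "\<And>e. e \<in> arcs D \<Longrightarrow> l e > 0"
  shows "\<exists>c. edge_coloring c D l"
proof
  \<comment> \<open>The sum of all colors serves as the number of colors.\<close>
  have "l e \<le> (\<Sum>e\<in>arcs D. l e)" if "e \<in> arcs D" for e
    using assms that by (intro member_le_sum) (auto intro: less_imp_le)
  moreover have "0 \<le> (\<Sum>e\<in>arcs D. l e)"
    using assms by (intro sum_nonneg) (auto intro: less_imp_le)
  ultimately show "edge_coloring (nat (\<Sum>e\<in>arcs D. l e)) D l"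
    using assms by (force simp: edge_coloring_def)
qed

lemma realizes_underlying:
  assumes "ugraph (underlying D)" "\<And>e. e \<in> arcs D \<Longrightarrow> l e > 0" "induced_pot D l \<subseteq> P"
  shows "realizes P (underlying D)"
proof -
  have "is_orientation D (underlying D)" by (simp add: is_orientation_def)
  moreover have "\<exists>c. edge_coloring c D l"
    using assms by (intro edge_coloring_exists) (auto simp: ugraph_def)
  ultimately show ?thesis using assms unfolding realizes_def by blast
qed

text \<open>
  A component of a disconnected digraph would be a realized graph with fewer vertices, so
  connectedness need not be assumed.
\<close>

lemma realizes3_underlying_iso:
  assumes r3: "realizes3 P G"
    and fin: "finite (verts D)" "finite (arcs D)" and ne: "verts D \<noteq> {}"
    and wf: "\<And>e. e \<in> arcs D \<Longrightarrow> tail D e \<in> verts D \<and> head D e \<in> verts D"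
    and pos: "\<And>e. e \<in> arcs D \<Longrightarrow> l e > 0"
    and P: "induced_pot D l \<subseteq> P"
    and card: "card (verts D) \<le> card (uverts G)"
  shows "ugraph_iso (underlying D) G"
proof -
  obtain r where r: "r \<in> verts D" using ne by blast
  define R where "R = (uadj (underlying D))\<^sup>*"
  \<comment> \<open>\<open>V\<close> is the component of \<open>r\<close>. No arc joins it to the
    rest (\<open>V_iff\<close>), so the arcs of \<open>K\<close> may be selected by their tails, and
    the vertices of \<open>V\<close> keep their tiles.\<close>
  define V where "V = {x \<in> verts D. (r, x) \<in> R}"
  define K where "K = \<lparr>verts = V, arcs = {e \<in> arcs D. tail D e \<in> V}, tail = tail D, head = head D\<rparr>"
  have K_simps [simp]: "verts K = V" "arcs K = {e \<in> arcs D. tail D e \<in> V}"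
    "tail K = tail D" "head K = head D"
    by (simp_all add: K_def)
  have adj: "(tail D e, head D e) \<in> uadj (underlying D)" "(head D e, tail D e) \<in> uadj (underlying D)"
    if "e \<in> arcs D" for e
    using that by (auto simp: uadj_def)
  have V_iff: "tail D e \<in> V \<longleftrightarrow> head D e \<in> V" if "e \<in> arcs D" for e
    using adj[OF that] wf[OF that] unfolding V_def R_def
    by (auto intro: rtrancl_into_rtrancl)
  have rV: "r \<in> V" using r by (simp add: V_def R_def)
  have adjK: "(x, y) \<in> uadj (underlying K)"
    if "(x, y) \<in> uadj (underlying D)" "x \<in> V" for x y
    using that V_iff by (auto simp: uadj_def)
  have to: "(r, x) \<in> (uadj (underlying K))\<^sup>* \<and> x \<in> V" if "(r, x) \<in> R" for x
    using that unfolding R_def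
  proof induction
    case base
    show ?case using rV by simp
  next
    case (step y z)
    then have "(y, z) \<in> uadj (underlying K)" using adjK by blast
    moreover have "z \<in> V"
      using step(2,3) wf V_iff by (auto simp: uadj_def)
    ultimately show ?case using step by (meson rtrancl_into_rtrancl)
  qed
  have symK: "sym ((uadj (underlying K))\<^sup>*)"
    by (rule sym_rtrancl) (auto simp: sym_def uadj_def)
  have "uconnected (underlying K)"
    unfolding uconnected_def
  proof (intro ballI)
    fix x y assume "x \<in> uverts (underlying K)" "y \<in> uverts (underlying K)"
    then have "(r, x) \<in> (uadj (underlying K))\<^sup>*" "(r, y) \<in> (uadj (underlying K))\<^sup>*"
      using to by (auto simp: V_def)
    then show "(x, y) \<in> (uadj (underlying K))\<^sup>*"
      using symK by (meson rtrancl_trans symD)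
  qed
  moreover have VD: "V \<subseteq> verts D" by (auto simp: V_def)
  ultimately have "ugraph (underlying K)"
    using fin rV V_iff unfolding ugraph_def by (auto intro: finite_subset)
  moreover have "induced_pot K l \<subseteq> P"
  proof -
    have "out_arcs K x = out_arcs D x" "in_arcs K x = in_arcs D x" if "x \<in> V" for x
      using that V_iff by (auto simp: out_arcs_def in_arcs_def)
    then have "vertex_tile K l x = vertex_tile D l x" if "x \<in> V" for x
      using that by (simp add: vertex_tile_def)
    then show ?thesis using P VD by (auto simp: induced_pot_def)
  qed
  ultimately have "realizes P (underlying K)"
    using pos by (intro realizes_underlying) auto
  moreover have "card V \<le> card (verts D)" using VD fin by (simp add: card_mono)
  ultimately have iso: "ugraph_iso (underlying K) G"
    using card by (intro realizes3_iso[OF r3]) simp_all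
  \<comment> \<open>The component has as many vertices as \<open>G\<close>, hence at least as many
    as \<open>D\<close>, so it is all of \<open>D\<close>.\<close>
  then have "card V = card (uverts G)" using ugraph_iso_card_verts by force
  then have "V = verts D" using VD fin card by (simp add: card_seteq)
  then have "underlying K = underlying D"
    using wf by (auto simp: underlying_def)
  then show ?thesis using iso by simp
qed

section \<open>The cube as a bipartite graph\<close>

definition parity :: "bit \<times> bit \<times> bit \<Rightarrow> bit" where
  "parity x = fst x + fst (snd x) + snd (snd x)"

definition antipode :: "bit \<times> bit \<times> bit \<Rightarrow> bit \<times> bit \<times> bit" where
  "antipode x = x + (1, 1, 1)"

definition cube_adj :: "bit \<times> bit \<times> bit \<Rightarrow> bit \<times> bit \<times> bit \<Rightarrow> bool" where
  "cube_adj x y \<longleftrightarrow> x - y \<in> {(1, 0, 0), (0, 1, 0), (0, 0, 1)}"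

lemma bit_forall: "(\<forall>x. P x) \<longleftrightarrow> P (0::bit) \<and> P 1"
  by (metis bit.exhaust)

text \<open>The view of the cube as a complete bipartite graph minus the perfect matching of
  antipodal pairs, verified by running through all pairs of vertices.\<close>

lemma cube_adj_iff: "cube_adj x y \<longleftrightarrow> parity x \<noteq> parity y \<and> y \<noteq> antipode x"
proof -
  have "\<forall>x y. cube_adj x y \<longleftrightarrow> parity x \<noteq> parity y \<and> y \<noteq> antipode x"
    unfolding split_paired_All
    by (simp add: cube_adj_def parity_def antipode_def bit_forall)
  then show ?thesis by blast
qed

lemma antipode_antipode [simp]: "antipode (antipode x) = x"
  by (cases x) (simp add: antipode_def add.assoc)

lemma antipode_inject [simp]: "antipode x = antipode y \<longleftrightarrow> x = y"
  by (metis antipode_antipode)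

lemma parity_antipode: "parity (antipode x) = parity x + 1"
proof -
  have "\<forall>x. parity (antipode x) = parity x + 1"
    unfolding split_paired_All by (simp add: parity_def antipode_def bit_forall)
  then show ?thesis by blast
qed

lemma bit_add_one_neq [simp]: "x + 1 \<noteq> (x::bit)" "x \<noteq> x + 1"
  by (cases x; simp)+

lemma bit_neq_trans: "x \<noteq> y \<Longrightarrow> y \<noteq> z \<Longrightarrow> x = (z::bit)"
  by (cases x; cases y; cases z) simp_all

lemma bit_neq_iff: "x \<noteq> y \<longleftrightarrow> x = y + (1::bit)"
  by (cases x; cases y) simp_all

lemma parity_antipode_iff [simp]:
  "parity (antipode x) = q \<longleftrightarrow> parity x \<noteq> q"
  "q = parity (antipode x) \<longleftrightarrow> parity x \<noteq> q"
  using parity_antipode[of x] bit_neq_iff by metis+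

lemma antipode_neq [simp]: "antipode x \<noteq> x" "x \<noteq> antipode x"
  by (metis parity_antipode bit_add_one_neq(1))+

lemma antipode_swap: "x = antipode y \<longleftrightarrow> y = antipode x"
  by auto

lemma cube_adj_sym: "cube_adj x y \<longleftrightarrow> cube_adj y x"
  unfolding cube_adj_iff by auto

lemma cube_adj_irrefl [simp]: "\<not> cube_adj x x"
  by (simp add: cube_adj_iff)

text \<open>Writing the vertices of one class as antipodes of the other turns edges into ordered
  pairs of distinct members of a single four-element class. Later arguments use these
  coordinates.\<close>

lemma cube_adj_antipode: "cube_adj x (antipode y) \<longleftrightarrow> parity x = parity y \<and> x \<noteq> y"
  unfolding cube_adj_iff by (auto simp: parity_antipode bit_neq_iff)

lemma parity_class:
  obtains a b c d where "distinct [a, b, c, d]" "{x. parity x = p} = {a, b, c, d}"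
proof (cases "p = 0")
  case True
  have "\<forall>x. parity x = 0 \<longleftrightarrow> x \<in> {(0, 0, 0), (0, 1, 1), (1, 0, 1), (1, 1, 0)}"
    unfolding split_paired_All by (simp add: parity_def bit_forall)
  then have "{x. parity x = p} = {(0, 0, 0), (0, 1, 1), (1, 0, 1), (1, 1, 0)}"
    unfolding True by blast
  then show thesis by (rule that[rotated]) simp
next
  case False
  then have p: "p = 1" by simp
  have "\<forall>x. parity x = 1 \<longleftrightarrow> x \<in> {(1, 1, 1), (1, 0, 0), (0, 1, 0), (0, 0, 1)}"
    unfolding split_paired_All by (simp add: parity_def bit_forall)
  then have "{x. parity x = p} = {(1, 1, 1), (1, 0, 0), (0, 1, 0), (0, 0, 1)}"
    unfolding p by blast
  then show thesis by (rule that[rotated]) simp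
qed

lemma parity_class_two:
  assumes "parity a = parity b" "a \<noteq> b"
  obtains c d where "distinct [a, b, c, d]" "{x. parity x = parity a} = {a, b, c, d}"
proof -
  obtain x y z w where *: "distinct [x, y, z, w]" "{v. parity v = parity a} = {x, y, z, w}"
    using parity_class by blast
  then have "card {v. parity v = parity a} = 4" by simp
  then have "card ({v. parity v = parity a} - {a, b}) = 2"
    using assms *(2) by (subst card_Diff_subset) auto
  then obtain c d where "{v. parity v = parity a} - {a, b} = {c, d}" "c \<noteq> d"
    by (meson card_2_iff)
  then have "distinct [a, b, c, d]" "{v. parity v = parity a} = {a, b, c, d}"
    using assms by auto
  then show thesis by (rule that)
qed

lemma cube_uedges: "uedges cube = {Upair x y | x y. cube_adj x y}"
  by (simp add: cube_def cube_adj_def)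

lemma Upair_in_cube_uedges [simp]: "Upair x y \<in> uedges cube \<longleftrightarrow> cube_adj x y"
  unfolding cube_uedges mem_Collect_eq Upair_inject using cube_adj_sym by metis

lemma cube_simps [simp]: "uverts cube = UNIV" "uends cube e = e"
  by (simp_all add: cube_def)

lemma card_cube_verts: "card (UNIV :: (bit \<times> bit \<times> bit) set) = 8"
proof -
  have UNIV_bit: "(UNIV :: bit set) = {0, 1}" by (auto simp: set_eq_iff)
  have "card (UNIV :: bit set) = 2" unfolding UNIV_bit by simp
  then show ?thesis by (simp flip: UNIV_Times_UNIV add: card_cartesian_product)
qed

lemma finite_cube_verts: "finite (UNIV :: (bit \<times> bit \<times> bit) set)"
  using card_cube_verts by (intro card_ge_0_finite) simp

section \<open>Rigidity of colorings of the cube\<close>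

text \<open>Without the edges \<open>ab\<close> and \<open>cd\<close>, the vertices \<open>a\<close>
  and \<open>d\<close> are still joined by a walk of even length, so they lie on the same side of
  any bipartition \<open>h\<close>. A new edge from \<open>a\<close> to \<open>d\<close>, as an
  exchange of heads produces, would thus destroy bipartiteness.\<close>

lemma swap_not_bipartite:
  fixes h :: "bit \<times> bit \<times> bit \<Rightarrow> bit"
  assumes adj: "cube_adj a b" "cube_adj c d" and ne: "a \<noteq> d" and par: "parity a = parity d"
    and h: "\<And>x y. cube_adj x y \<Longrightarrow> Upair x y \<noteq> Upair a b \<Longrightarrow> Upair x y \<noteq> Upair c d \<Longrightarrow> h x \<noteq> h y"
  shows "h a = h d"
proof -
  obtain x y where dist: "distinct [a, d, x, y]" and cls: "{v. parity v = parity a} = {a, d, x, y}"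
    using parity_class_two[OF par ne] by blast
  have p: "parity x = parity a" "parity y = parity a" using cls by auto
  have bc: "parity b \<noteq> parity a" "parity c \<noteq> parity a"
    using adj par unfolding cube_adj_iff by auto
  have step: "h v \<noteq> h u" if "cube_adj v u" "parity u \<noteq> parity a" "u \<noteq> b" "u \<noteq> c" for u v
    using that adj par by (intro h) auto
  \<comment> \<open>The antipode of \<open>z\<close> is adjacent to the three other members of the
    class. If it is neither \<open>b\<close> nor \<open>c\<close>, it keeps these three edges, so
    the three members lie on the same side.\<close>
  have via: "h v = h w" if "parity v = parity a" "parity w = parity a" "parity z = parity a"
    "v \<noteq> z" "w \<noteq> z" "antipode z \<noteq> b" "antipode z \<noteq> c" for v w z
  proof -
    have "parity (antipode z) \<noteq> parity a" using that(3) by (simp add: parity_antipode bit_neq_iff)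
    then have "h v \<noteq> h (antipode z)" "h w \<noteq> h (antipode z)"
      using that step[of v "antipode z"] step[of w "antipode z"] by (simp_all add: cube_adj_antipode)
    then show ?thesis by (metis bit_neq_trans)
  qed
  \<comment> \<open>\<open>b\<close> and \<open>c\<close> can block both direct connections of
    \<open>a\<close> and \<open>d\<close> only by being the antipodes of \<open>x\<close> and
    \<open>y\<close>. Then the antipodes of \<open>d\<close> and \<open>a\<close> are free and give
    a detour through \<open>x\<close>.\<close>
  consider "antipode x \<noteq> b" "antipode x \<noteq> c" | "antipode y \<noteq> b" "antipode y \<noteq> c"
    | "b = antipode x" "c = antipode y" | "b = antipode y" "c = antipode x"
    using dist by (metis antipode_inject distinct_length_2_or_more)
  then show ?thesis
  proof cases
    case 1
    then show ?thesis using dist p par by (intro via[of a d x]) auto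
  next
    case 2
    then show ?thesis using dist p par by (intro via[of a d y]) auto
  next
    case 3
    then have "h a = h x" "h x = h d"
      using dist p par by (intro via[of a x d] via[of x d a]; auto)+
    then show ?thesis by simp
  next
    case 4
    then have "h a = h x" "h x = h d"
      using dist p par by (intro via[of a x d] via[of x d a]; auto)+
    then show ?thesis by simp
  qed
qed

lemma is_orientation_cubeD:
  assumes "is_orientation D cube"
  shows "verts D = UNIV" "arcs D = uedges cube"
    "e \<in> uedges cube \<Longrightarrow> Upair (tail D e) (head D e) = e"
  using assms unfolding is_orientation_def by auto

lemma is_orientation_cube_ends:
  assumes "is_orientation D cube" "cube_adj x y"
  shows "tail D (Upair x y) = x \<and> head D (Upair x y) = y \<or>
    tail D (Upair x y) = y \<and> head D (Upair x y) = x"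
  using is_orientation_cubeD(3)[OF assms(1), of "Upair x y"] assms(2) by simp

lemma finite_cube_uedges: "finite (uedges cube)"
proof -
  have "uedges cube \<subseteq> (\<lambda>(x, y). Upair x y) ` UNIV" by (auto simp: cube_uedges)
  then show ?thesis
    using finite_Prod_UNIV[OF finite_cube_verts finite_cube_verts]
    by (rule finite_subset[OF _ finite_imageI])
qed

text \<open>Let arcs \<open>ab\<close> and \<open>cd\<close> of one color have distinct tails and
  distinct heads. After exchanging heads the arcs are \<open>ad\<close> and \<open>cb\<close>, and
  the graph is still a cube. Being bipartite, it forces \<open>a\<close> and \<open>d\<close> into
  different classes; being simple, it forbids that \<open>ad\<close> doubles an old edge. So
  \<open>d\<close> is the antipode of \<open>a\<close>, and likewise \<open>b\<close> that of
  \<open>c\<close>.\<close>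

lemma equal_color_arcs:
  assumes r3: "realizes3 P cube" and D: "is_orientation D cube"
    and pos: "\<And>e. e \<in> uedges cube \<Longrightarrow> l e > 0" and P: "induced_pot D l \<subseteq> P"
    and e: "e1 \<in> uedges cube" "e2 \<in> uedges cube" "e1 \<noteq> e2" and same: "l e1 = l e2"
  shows "tail D e1 = tail D e2 \<or> head D e1 = head D e2 \<or>
    head D e2 = antipode (tail D e1) \<and> head D e1 = antipode (tail D e2)"
proof (rule ccontr)
  note D_simps [simp] = is_orientation_cubeD[OF D]
  define a b c d where abcd: "a = tail D e1" "b = head D e1" "c = tail D e2" "d = head D e2"
  assume "\<not> ?thesis"
  then have neg: "a \<noteq> c" "b \<noteq> d" "\<not> (d = antipode a \<and> b = antipode c)"
    unfolding abcd by auto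
  have e12: "e1 = Upair a b" "e2 = Upair c d" using e by (simp_all add: abcd)
  then have adj: "cube_adj a b" "cube_adj c d" using e by auto
  define \<pi> where "\<pi> = transpose e1 e2"
  \<comment> \<open>Only the heads are composed with \<pi>. The set of in-arcs of a vertex is
    replaced by its image under \<pi>, which preserves colors, so every tile persists.\<close>
  define D' where "D' = \<lparr>verts = UNIV, arcs = uedges cube, tail = tail D, head = head D \<circ> \<pi>\<rparr>"
  have D'_simps [simp]: "verts D' = UNIV" "arcs D' = uedges cube" "tail D' = tail D"
    "head D' = head D \<circ> \<pi>"
    by (simp_all add: D'_def)
  have \<pi>: "\<pi> x \<in> uedges cube \<longleftrightarrow> x \<in> uedges cube" "\<pi> (\<pi> x) = x" "l (\<pi> x) = l x" "inj \<pi>" for x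
    using e same by (auto simp: \<pi>_def transpose_def inj_def)
  have "vertex_tile D' l x = vertex_tile D l x" for x
  proof -
    have "in_arcs D' x = \<pi> ` in_arcs D x"
    proof (intro set_eqI iffI)
      fix y assume "y \<in> in_arcs D' x"
      then have "\<pi> y \<in> in_arcs D x" using \<pi> by (simp add: in_arcs_def)
      then show "y \<in> \<pi> ` in_arcs D x" using \<pi>(2) by (metis imageI)
    next
      fix y assume "y \<in> \<pi> ` in_arcs D x"
      then show "y \<in> in_arcs D' x" using \<pi> by (auto simp: in_arcs_def)
    qed
    then have "mset_set (in_arcs D' x) = image_mset \<pi> (mset_set (in_arcs D x))"
      by (simp add: image_mset_mset_set inj_on_subset[OF \<pi>(4)])
    moreover have "out_arcs D' x = out_arcs D x" by (simp add: out_arcs_def)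
    ultimately show ?thesis
      unfolding vertex_tile_def by (simp add: multiset.map_comp comp_def \<pi>(3))
  qed
  then have "induced_pot D' l \<subseteq> P" using P by (simp add: induced_pot_def)
  then have "ugraph_iso (underlying D') cube"
    using pos by (intro realizes3_underlying_iso[OF r3])
      (auto simp: finite_cube_verts finite_cube_uedges)
  then obtain f g where f: "inj f" and g: "bij_betw g (uedges cube) (uedges cube)"
    and fg: "\<And>x. x \<in> uedges cube \<Longrightarrow> g x = Upair (f (tail D x)) (f (head D (\<pi> x)))"
    unfolding ugraph_iso_def by (auto simp: bij_betw_def)
  \<comment> \<open>\<open>h\<close> pulls the bipartition of the cube back along \<open>f\<close>;
    it separates the ends of every arc of \<open>D'\<close>.\<close>
  define h where "h v = parity (f v)" for v
  have fadj: "cube_adj (f (tail D x)) (f (head D (\<pi> x)))" if "x \<in> uedges cube" for x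
    using fg[OF that] bij_betwE[OF g] that by (metis Upair_in_cube_uedges)
  have \<pi>12: "\<pi> e1 = e2" "\<pi> e2 = e1" by (simp_all add: \<pi>_def)
  have fad: "cube_adj (f a) (f d)" "cube_adj (f c) (f b)"
    using fadj[OF e(1)] fadj[OF e(2)] by (simp_all add: \<pi>12 abcd)
  then have had: "h a \<noteq> h d" "h c \<noteq> h b" and ne: "a \<noteq> d" "c \<noteq> b"
    unfolding h_def cube_adj_iff by auto
  note ends = is_orientation_cube_ends[OF D]
  have \<pi>_other: "\<pi> x = x" if "x \<noteq> e1" "x \<noteq> e2" for x using that by (simp add: \<pi>_def)
  have other: "g (Upair x y) = Upair (f x) (f y)"
    if "cube_adj x y" "Upair x y \<noteq> e1" "Upair x y \<noteq> e2" for x y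
    using fg[of "Upair x y"] \<pi>_other[OF that(2,3)] ends[OF that(1)] that(1) by auto
  have hne: "h x \<noteq> h y" if "cube_adj x y" "Upair x y \<noteq> e1" "Upair x y \<noteq> e2" for x y
    using other[OF that] that(1) bij_betwE[OF g] unfolding h_def
    by (metis Upair_in_cube_uedges cube_adj_iff)
  have "parity a = parity c"
  proof (rule ccontr)
    assume "parity a \<noteq> parity c"
    then have "parity a = parity d" using adj(2) unfolding cube_adj_iff by (metis bit_neq_trans)
    then show False
      using swap_not_bipartite[OF adj ne(1), of h] hne had(1) unfolding e12 by blast
  qed
  then have par: "parity a \<noteq> parity d" "parity c \<noteq> parity b"
    using adj unfolding cube_adj_iff by auto
  have ginj: "x = y" if "x \<in> uedges cube" "y \<in> uedges cube" "g x = g y" for x y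
    using g that by (auto simp: bij_betw_def dest: inj_onD)
  have "\<not> cube_adj a d"
  proof
    assume ad: "cube_adj a d"
    \<comment> \<open>The old edge \<open>ad\<close> and the exchanged arc \<open>e1\<close> have
      the same ends in \<open>D'\<close>, hence the same image under the injective
      \<open>g\<close>.\<close>
    have "Upair a d \<noteq> e1" "Upair a d \<noteq> e2" using neg ne unfolding e12 by auto
    moreover have "g e1 = Upair (f a) (f d)" using fg[OF e(1)] by (simp add: \<pi>12 abcd)
    ultimately show False using ginj[of "Upair a d" e1] other[OF ad] ad e(1) by simp
  qed
  moreover have "\<not> cube_adj c b"
  proof
    assume cb: "cube_adj c b"
    have "Upair c b \<noteq> e1" "Upair c b \<noteq> e2" using neg ne unfolding e12 by auto
    moreover have "g e2 = Upair (f c) (f b)" using fg[OF e(2)] by (simp add: \<pi>12 abcd)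
    ultimately show False using ginj[of "Upair c b" e2] other[OF cb] cb e(2) by simp
  qed
  ultimately show False using neg(3) par unfolding cube_adj_iff by blast
qed

text \<open>
  \<open>C x y\<close> is the color of the edge \<open>xy\<close> with the sign with which it enters the tile of \<open>x\<close>.
\<close>

definition cube_tile :: "(bit \<times> bit \<times> bit \<Rightarrow> bit \<times> bit \<times> bit \<Rightarrow> int) \<Rightarrow> bit \<times> bit \<times> bit \<Rightarrow> tile" where
  "cube_tile C x = image_mset (C x) (mset_set {y. cube_adj x y})"

text \<open>The second condition is \<open>equal_color_arcs\<close> in signed form: equal values
  mean equal colors, with \<open>a\<close> and \<open>c\<close> both tails or both heads. Reversing
  both arcs leaves the three alternatives unchanged, so one formula covers both cases.\<close>

definition rigid_coloring :: "(bit \<times> bit \<times> bit \<Rightarrow> bit \<times> bit \<times> bit \<Rightarrow> int) \<Rightarrow> bool" where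
  "rigid_coloring C \<longleftrightarrow>
     (\<forall>x y. cube_adj x y \<longrightarrow> C y x = - C x y) \<and>
     (\<forall>a b c d. cube_adj a b \<longrightarrow> cube_adj c d \<longrightarrow> C a b = C c d \<longrightarrow>
        a = c \<or> b = d \<or> d = antipode a \<and> b = antipode c)"

lemma realizes3_cube_rigid:
  assumes r3: "realizes3 P cube"
  obtains C where "rigid_coloring C" "\<And>x. cube_tile C x \<in> P"
proof -
  obtain D k l where D: "is_orientation D cube" and k: "edge_coloring k D l"
    and P: "induced_pot D l \<subseteq> P"
    using r3 unfolding realizes3_def realizes_def by blast
  note D_simps [simp] = is_orientation_cubeD[OF D]
  have pos: "l e > 0" if "e \<in> uedges cube" for e
    using k that unfolding edge_coloring_def by force
  note ends = is_orientation_cube_ends[OF D]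
  have Upair_comm: "Upair x y = Upair y x" for x y :: "bit \<times> bit \<times> bit" by simp
  define C where "C x y = (if tail D (Upair x y) = x then l (Upair x y) else - l (Upair x y))" for x y
  have anti: "C y x = - C x y" if "cube_adj x y" for x y
    using ends[OF that] that unfolding C_def Upair_comm[of y x] by auto
  have rigid: "a = c \<or> b = d \<or> d = antipode a \<and> b = antipode c"
    if adj: "cube_adj a b" "cube_adj c d" and eq: "C a b = C c d" for a b c d
  proof -
    have l: "l (Upair a b) > 0" "l (Upair c d) > 0" using adj pos by auto
    then have same: "l (Upair a b) = l (Upair c d)"
      and sgn: "tail D (Upair a b) = a \<longleftrightarrow> tail D (Upair c d) = c"
      using eq unfolding C_def by (auto split: if_splits)
    show ?thesis
    \<comment> \<open>If both pairs are the same edge, the common sign tells which end is the tail,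
      so \<open>a = c\<close>.\<close>
    proof (cases "Upair a b = Upair c d")
      case True
      then have "tail D (Upair a b) = a \<longleftrightarrow> tail D (Upair a b) = c"
        using sgn by (simp only: True)
      then show ?thesis using True ends[OF adj(1)] by (metis Upair_inject)
    next
      case False
      show ?thesis
        using equal_color_arcs[OF r3 D pos P _ _ False same] adj sgn ends[OF adj(1)] ends[OF adj(2)]
        by auto
    qed
  qed
  have tile: "cube_tile C x = vertex_tile D l x" for x
  proof -
    have fin: "finite (out_arcs D x)" "finite (in_arcs D x)"
      by (auto simp: out_arcs_def in_arcs_def finite_cube_uedges)
    have noloop: "tail D e \<noteq> head D e" if "e \<in> uedges cube" for e
      using D_simps(3)[OF that] that by (metis Upair_in_cube_uedges cube_adj_irrefl)
    \<comment> \<open>The cube has no loops, so the arcs at \<open>x\<close> split disjointly into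
      out-arcs and in-arcs and correspond to the neighbors of \<open>x\<close>.\<close>
    have un: "out_arcs D x \<union> in_arcs D x = Upair x ` {y. cube_adj x y}"
    proof (intro set_eqI iffI)
      fix e assume e: "e \<in> out_arcs D x \<union> in_arcs D x"
      then have "e \<in> uedges cube" by (auto simp: out_arcs_def in_arcs_def)
      moreover from this have "e = Upair x (tail D e) \<or> e = Upair x (head D e)"
        using e D_simps(3)[of e] Upair_comm[of "tail D e"] by (auto simp: out_arcs_def in_arcs_def)
      ultimately show "e \<in> Upair x ` {y. cube_adj x y}"
        by (metis (mono_tags) Upair_in_cube_uedges image_eqI mem_Collect_eq)
    next
      fix e assume "e \<in> Upair x ` {y. cube_adj x y}"
      then obtain y where "e = Upair x y" "cube_adj x y" by blast
      then show "e \<in> out_arcs D x \<union> in_arcs D x"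
        using ends[of x y] by (auto simp: out_arcs_def in_arcs_def)
    qed
    have disj: "out_arcs D x \<inter> in_arcs D x = {}"
      using noloop unfolding out_arcs_def in_arcs_def by fastforce
    define s where "s e = (if tail D e = x then l e else - l e)" for e
    have "vertex_tile D l x = image_mset s (mset_set (out_arcs D x)) + image_mset s (mset_set (in_arcs D x))"
      unfolding vertex_tile_def
    proof (intro arg_cong2[where f = "(+)"] image_mset_cong)
      fix e assume "e \<in># mset_set (out_arcs D x)"
      then show "l e = s e" using fin by (simp add: s_def out_arcs_def)
    next
      fix e assume "e \<in># mset_set (in_arcs D x)"
      then have "e \<in> uedges cube" "head D e = x" using fin by (auto simp: in_arcs_def)
      then show "- l e = s e" using noloop[of e] by (simp add: s_def)
    qed
    also have "\<dots> = image_mset s (mset_set (Upair x ` {y. cube_adj x y}))"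
      unfolding un[symmetric] using fin disj by (simp add: mset_set_Union)
    also have "mset_set (Upair x ` {y. cube_adj x y}) = image_mset (Upair x) (mset_set {y. cube_adj x y})"
      by (subst image_mset_mset_set) (auto intro: inj_onI)
    finally have "vertex_tile D l x = image_mset (s \<circ> Upair x) (mset_set {y. cube_adj x y})"
      by (simp add: multiset.map_comp)
    moreover have "C x = s \<circ> Upair x" by (simp add: fun_eq_iff s_def C_def)
    ultimately show ?thesis by (simp add: cube_tile_def)
  qed
  show thesis
  proof (rule that)
    show "rigid_coloring C" unfolding rigid_coloring_def using anti rigid by blast
    show "cube_tile C x \<in> P" for x
      using P unfolding tile induced_pot_def by auto
  qed
qed

section \<open>Lower bounds\<close>

lemma rigid_coloring_antisym: "rigid_coloring C \<Longrightarrow> cube_adj x y \<Longrightarrow> C y x = - C x y"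
  unfolding rigid_coloring_def by blast

lemma rigid_coloringD:
  "rigid_coloring C \<Longrightarrow> cube_adj a b \<Longrightarrow> cube_adj c d \<Longrightarrow> C a b = C c d \<Longrightarrow>
    a = c \<or> b = d \<or> d = antipode a \<and> b = antipode c"
  unfolding rigid_coloring_def by blast

text \<open>A vanishing value would equal the value of the reversed edge, which none of the three
  alternatives allows.\<close>

lemma rigid_coloring_nonzero:
  assumes "rigid_coloring C" "cube_adj x y"
  shows "C x y \<noteq> 0"
proof
  assume "C x y = 0"
  then have "C x y = C y x" using rigid_coloring_antisym[OF assms] by simp
  then show False
    using rigid_coloringD[OF assms, of y x] assms(2) cube_adj_sym by fastforce
qed

text \<open>Otherwise \<open>ab\<close> and the reversed edge \<open>dc\<close> have equal values
  although \<open>a\<close> and \<open>d\<close> lie in different classes, and parity excludes all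
  three alternatives. So unsigned colors suffice when edges are read from one class.\<close>

lemma rigid_coloring_abs:
  assumes "rigid_coloring C" "cube_adj a b" "cube_adj c d" "parity a = parity c" "\<bar>C a b\<bar> = \<bar>C c d\<bar>"
  shows "C a b = C c d"
proof (rule ccontr)
  assume "C a b \<noteq> C c d"
  then have "C a b = C d c"
    using assms(5) rigid_coloring_antisym[OF assms(1,3)] by (auto simp: abs_eq_iff)
  moreover have "cube_adj d c" using assms(3) cube_adj_sym by blast
  ultimately have "a = d \<or> b = c \<or> c = antipode a \<and> b = antipode d"
    using rigid_coloringD[OF assms(1,2)] by blast
  then show False
    using assms(2-4) unfolding cube_adj_iff by auto
qed

lemma finite_cube_nbrs [simp]: "finite {y. cube_adj x y}"
  using finite_cube_verts by (rule finite_subset[rotated]) simp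

lemma cube_nbrs: "{y. cube_adj x y} = antipode ` ({v. parity v = parity x} - {x})"
proof (intro set_eqI iffI)
  fix y assume "y \<in> {y. cube_adj x y}"
  then have "cube_adj x (antipode (antipode y))" by simp
  then have "antipode y \<in> {v. parity v = parity x} - {x}" unfolding cube_adj_antipode by auto
  then show "y \<in> antipode ` ({v. parity v = parity x} - {x})"
    by (metis antipode_antipode imageI)
qed (auto simp: cube_adj_antipode)

lemma card_cube_nbrs: "card {y. cube_adj x y} = 3"
proof -
  obtain a b c d where *: "distinct [a, b, c, d]" "{v. parity v = parity x} = {a, b, c, d}"
    using parity_class by blast
  have "x \<in> {v. parity v = parity x}" by simp
  then have "card ({v. parity v = parity x} - {x}) = 3"
    using * by (subst card_Diff_singleton) auto
  then show ?thesis
    unfolding cube_nbrs by (subst card_image) (auto intro: inj_onI)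
qed

lemma set_cube_tile: "set_mset (cube_tile C x) = C x ` {y. cube_adj x y}"
  by (simp add: cube_tile_def)

section \<open>Vertices with equal tiles\<close>

lemma equal_tilesE:
  assumes "cube_tile C x = cube_tile C y" "cube_adj x z"
  obtains z' where "cube_adj y z'" "C x z = C y z'"
proof -
  have "C x z \<in># cube_tile C y" using assms by (auto simp: set_cube_tile simp flip: assms(1))
  then show thesis using that by (auto simp: set_cube_tile)
qed

text \<open>For vertices of different parity, matching edges \<open>xz\<close> and
  \<open>yz'\<close> would have \<open>z\<close> in the class of \<open>y\<close> and
  \<open>z'\<close> in the class of \<open>x\<close>, so they could neither share \<open>z\<close>
  nor be antipodal.\<close>

lemma equal_tiles_parity:
  assumes C: "rigid_coloring C" and eq: "cube_tile C x = cube_tile C y" and ne: "x \<noteq> y"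
  shows "parity x = parity y"
proof (rule ccontr)
  assume par: "parity x \<noteq> parity y"
  obtain z where z: "cube_adj x z"
    using card_cube_nbrs[of x] by (metis card.empty empty_Collect_eq zero_neq_numeral)
  obtain z' where z': "cube_adj y z'" "C x z = C y z'" using equal_tilesE[OF eq z] .
  have "parity z \<noteq> parity x" "parity z' = parity x"
    using z z'(1) par unfolding cube_adj_iff by (auto dest: bit_neq_trans)
  then show False
    using rigid_coloringD[OF C z z'] ne by auto
qed

text \<open>The edge at \<open>y\<close> matching \<open>xz\<close> must end in \<open>z\<close>
  too, because the antipodal alternative needs \<open>z\<close> to be the antipode of
  \<open>y\<close>.\<close>

lemma equal_tiles_common:
  assumes C: "rigid_coloring C" and eq: "cube_tile C x = cube_tile C y" and ne: "x \<noteq> y"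
    and z: "cube_adj x z" "z \<noteq> antipode y"
  shows "C x z = C y z"
proof -
  obtain z' where z': "cube_adj y z'" "C x z = C y z'" using equal_tilesE[OF eq z(1)] .
  then show ?thesis using rigid_coloringD[OF C z(1) z'] ne z(2) by blast
qed

text \<open>The antipode of \<open>y\<close> is not adjacent to \<open>y\<close>, so here the
  matching edge can only be the antipodal one.\<close>

lemma equal_tiles_antipode:
  assumes C: "rigid_coloring C" and eq: "cube_tile C x = cube_tile C y" and ne: "x \<noteq> y"
  shows "C x (antipode y) = C y (antipode x)"
proof -
  have adj: "cube_adj x (antipode y)"
    using equal_tiles_parity[OF assms] ne by (simp add: cube_adj_antipode)
  obtain z' where z': "cube_adj y z'" "C x (antipode y) = C y z'" using equal_tilesE[OF eq adj] .
  moreover have "z' \<noteq> antipode y" using z'(1) unfolding cube_adj_iff by blast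
  ultimately show ?thesis using rigid_coloringD[OF C adj z'] ne by auto
qed

text \<open>Comparing \<open>x\<close> with \<open>w\<close> and \<open>x\<close> with
  \<open>y\<close> gives the edges from \<open>w\<close> to the antipode of \<open>y\<close> and
  from \<open>y\<close> to the antipode of \<open>x\<close> the same value. They share no end in
  either role and are not antipodal.\<close>

lemma no_three_equal_tiles:
  assumes C: "rigid_coloring C" and ne: "distinct [x, y, w]"
    and eq: "cube_tile C x = cube_tile C y" "cube_tile C x = cube_tile C w"
  shows False
proof -
  have par: "parity x = parity y" "parity x = parity w"
    using equal_tiles_parity[OF C] eq ne by auto
  have "C x (antipode y) = C w (antipode y)"
    using ne par by (intro equal_tiles_common[OF C eq(2)]) (auto simp: cube_adj_antipode)
  moreover have "C x (antipode y) = C y (antipode x)"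
    using ne by (intro equal_tiles_antipode[OF C eq(1)]) auto
  ultimately have "C w (antipode y) = C y (antipode x)" by simp
  then show False
    using rigid_coloringD[OF C, of w "antipode y" y "antipode x"] ne par
    by (auto simp: cube_adj_antipode)
qed

text \<open>If \<open>p\<close> and \<open>q\<close> differed, one of the two equally colored
  neighbors of \<open>p\<close> would be a common neighbor \<open>r\<close>. Then \<open>qr\<close>
  has the value of \<open>pr'\<close> for the other neighbor \<open>r'\<close>, against
  rigidity.\<close>

lemma repeated_color_unique_tile:
  assumes C: "rigid_coloring C" and eq: "cube_tile C p = cube_tile C q"
    and r: "cube_adj p r1" "cube_adj p r2" "r1 \<noteq> r2" "C p r1 = C p r2"
  shows "p = q"
proof (rule ccontr)
  assume ne: "p \<noteq> q"
  obtain r r' where r': "cube_adj p r" "cube_adj p r'" "r \<noteq> r'" "C p r = C p r'" "r \<noteq> antipode q"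
    using r by (cases "r1 = antipode q") (metis, metis)
  have "cube_adj q r"
    using r'(1,5) equal_tiles_parity[OF C eq ne] unfolding cube_adj_iff by (metis antipode_swap)
  moreover have "C q r = C p r'" using equal_tiles_common[OF C eq ne r'(1,5)] r'(4) by simp
  ultimately show False
    using rigid_coloringD[OF C _ r'(2), of q r] r' ne unfolding cube_adj_iff by blast
qed

text \<open>A repeated tile occurs exactly twice, so a class with fewer than three tiles consists of
  two pairs. Each vertex of the other class is adjacent to both members of some pair and sees them
  with the same color, so its tile is unique by \<open>repeated_color_unique_tile\<close>.\<close>

lemma tiles_of_parity_class:
  assumes C: "rigid_coloring C"
  shows "3 \<le> card (cube_tile C ` {x. parity x = p}) \<or>
    2 \<le> card (cube_tile C ` {x. parity x = p}) \<and> inj_on (cube_tile C) {x. parity x \<noteq> p}"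
proof (cases "inj_on (cube_tile C) {x. parity x = p}")
  case True
  obtain a b c d where "distinct [a, b, c, d]" "{x. parity x = p} = {a, b, c, d}"
    using parity_class by blast
  then have "card {x. parity x = p} = 4" by simp
  then show ?thesis using card_image[OF True] by simp
next
  case False
  then obtain x y where xy: "parity x = p" "parity y = p" "x \<noteq> y" "cube_tile C x = cube_tile C y"
    by (auto simp: inj_on_def)
  then obtain u w where dist: "distinct [x, y, u, w]" and cls: "{v. parity v = p} = {x, y, u, w}"
    using parity_class_two[of x y] by metis
  have par: "parity u = p" "parity w = p" using cls by auto
  have ne: "cube_tile C x \<noteq> cube_tile C u" "cube_tile C x \<noteq> cube_tile C w"
    using no_three_equal_tiles[OF C _ xy(4), of u] no_three_equal_tiles[OF C _ xy(4), of w] dist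
    by auto
  have img: "cube_tile C ` {v. parity v = p} = {cube_tile C x, cube_tile C u, cube_tile C w}"
    unfolding cls using xy(4) by auto
  show ?thesis
  proof (cases "cube_tile C u = cube_tile C w")
    case False
    then show ?thesis unfolding img using ne by simp
  next
    case True
    have pair: "\<exists>r1 r2. cube_adj q r1 \<and> cube_adj q r2 \<and> r1 \<noteq> r2 \<and> C q r1 = C q r2"
      if "s \<noteq> t" "parity s = p" "parity t = p" "cube_tile C s = cube_tile C t"
        "parity q \<noteq> p" "antipode q \<noteq> s" "antipode q \<noteq> t" for q s t
    proof -
      have adj: "cube_adj s q" "cube_adj t q"
        using that unfolding cube_adj_iff by auto
      then have "C s q = C t q" using that by (intro equal_tiles_common[OF C]) auto
      then have "C q s = C q t" using rigid_coloring_antisym[OF C] adj by simp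
      then show ?thesis using adj cube_adj_sym that(1) by blast
    qed
    have "\<exists>r1 r2. cube_adj q r1 \<and> cube_adj q r2 \<and> r1 \<noteq> r2 \<and> C q r1 = C q r2"
      if "parity q \<noteq> p" for q
    proof (cases "antipode q \<in> {x, y}")
      case False
      then show ?thesis using xy that by (intro pair[of x y]) auto
    next
      case in_xy: True
      then show ?thesis using dist par True that by (intro pair[of u w]) auto
    qed
    then have "inj_on (cube_tile C) {x. parity x \<noteq> p}"
      using repeated_color_unique_tile[OF C] unfolding inj_on_def by blast
    then show ?thesis unfolding img using ne True by simp
  qed
qed

text \<open>Either both classes show at least three tiles, or one shows at least two and the other
  four. No tile occurs in both classes.\<close>

lemma card_rigid_tiles:
  assumes C: "rigid_coloring C"
  shows "6 \<le> card (range (cube_tile C))"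
proof -
  define E where "E p = cube_tile C ` {x. parity x = p}" for p
  have other: "{x. parity x \<noteq> 0} = {x. parity x = 1}" "{x. parity x \<noteq> 1} = {x. parity x = 0}"
    by auto
  have "card (E p) = 4" if "inj_on (cube_tile C) {x. parity x = p}" for p
  proof -
    obtain a b c d where "distinct [a, b, c, d]" "{x. parity x = p} = {a, b, c, d}"
      using parity_class by blast
    then have "card {x. parity x = p} = 4" by simp
    then show ?thesis using card_image[OF that] by (simp add: E_def)
  qed
  then have "3 \<le> card (E 0) \<or> 2 \<le> card (E 0) \<and> card (E 1) = 4"
    "3 \<le> card (E 1) \<or> 2 \<le> card (E 1) \<and> card (E 0) = 4"
    using tiles_of_parity_class[OF C, of 0] tiles_of_parity_class[OF C, of 1]
    unfolding E_def other by blast+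
  then have "6 \<le> card (E 0) + card (E 1)" by linarith
  also have "\<dots> = card (E 0 \<union> E 1)"
  proof (rule card_Un_disjoint[symmetric])
    show "finite (E 0)" "finite (E 1)"
      unfolding E_def using finite_cube_verts by (auto intro: finite_subset)
    show "E 0 \<inter> E 1 = {}"
      unfolding E_def using equal_tiles_parity[OF C] by fastforce
  qed
  also have "E 0 \<union> E 1 = range (cube_tile C)"
    unfolding E_def using other by (auto simp flip: image_Un)
  finally show ?thesis .
qed

lemma realizes3_cube_card:
  assumes "realizes3 P cube" "finite P"
  shows "6 \<le> card P"
proof -
  obtain C where C: "rigid_coloring C" "\<And>x. cube_tile C x \<in> P"
    using realizes3_cube_rigid[OF assms(1)] by metis
  have "6 \<le> card (range (cube_tile C))" by (rule card_rigid_tiles[OF C(1)])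
  also have "\<dots> \<le> card P" using C(2) assms(2) by (intro card_mono) auto
  finally show ?thesis .
qed

section \<open>The number of colors\<close>

text \<open>
  Here \<open>w i j\<close> stands for the color of the edge between \<open>i\<close> and the antipode of \<open>j\<close>, where
  \<open>a\<close>, \<open>b\<close>, \<open>c\<close>, \<open>d\<close> form a parity class. The four edges \<open>ab\<close>, \<open>bc\<close>, \<open>cd\<close>, \<open>da\<close> have distinct
  colors, and the color of \<open>ac\<close> determines all others.
\<close>

lemma four_color_stars:
  fixes w :: "'a \<Rightarrow> 'a \<Rightarrow> 'b"
  assumes dist: "distinct [a, b, c, d]" and A: "A = {a, b, c, d}"
    and rigid: "\<And>i j k m. \<lbrakk>i \<in> A; j \<in> A; k \<in> A; m \<in> A; i \<noteq> j; k \<noteq> m; w i j = w k m\<rbrakk> \<Longrightarrow>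
      i = k \<or> j = m \<or> k = j \<and> m = i"
    and S: "finite S" "card S \<le> 4" "\<And>i j. i \<in> A \<Longrightarrow> j \<in> A \<Longrightarrow> i \<noteq> j \<Longrightarrow> w i j \<in> S"
  shows "(\<forall>i\<in>A. \<forall>j\<in>A. \<forall>k\<in>A. i \<noteq> j \<longrightarrow> i \<noteq> k \<longrightarrow> w i j = w i k) \<or>
    (\<forall>i\<in>A. \<forall>j\<in>A. \<forall>k\<in>A. i \<noteq> j \<longrightarrow> i \<noteq> k \<longrightarrow> w j i = w k i)"
proof -
  have inA: "a \<in> A" "b \<in> A" "c \<in> A" "d \<in> A" using A by auto
  have ne: "a \<noteq> b" "a \<noteq> c" "a \<noteq> d" "b \<noteq> c" "b \<noteq> d" "c \<noteq> d" using dist by auto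
  note ne' = ne ne[symmetric]
  have R: "w i j \<noteq> w k m" if "i \<in> A" "j \<in> A" "k \<in> A" "m \<in> A" "i \<noteq> j" "k \<noteq> m"
    "i \<noteq> k" "j \<noteq> m" "k \<noteq> j \<or> m \<noteq> i" for i j k m
    using rigid[of i j k m] that by blast
  let ?T = "{w a b, w b c, w c d, w d a}"
  \<comment> \<open>No two of these four pairs may share a color under \<open>rigid\<close>, so they
    already exhaust \<open>S\<close>.\<close>
  have "card ?T = 4"
    using R[of a b b c] R[of a b c d] R[of a b d a] R[of b c c d] R[of b c d a] R[of c d d a]
    by (simp add: inA ne')
  moreover have "?T \<subseteq> S" using S(3) inA ne' by auto
  ultimately have "?T = S" using S(1,2) by (intro card_seteq) auto
  then have T: "w i j \<in> ?T" if "i \<in> A" "j \<in> A" "i \<noteq> j" for i j using S(3)[OF that] by simp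
  \<comment> \<open>A diagonal may only share the color of the cycle edge with the same first or the
    same second index. A reversed cycle edge may in addition share the color of its
    reversal.\<close>
  have ac: "w a c = w a b \<or> w a c = w b c"
    using T[of a c] R[of a c c d] R[of a c d a] by (auto simp: inA ne')
  have bd: "w b d = w b c \<or> w b d = w c d"
    using T[of b d] R[of b d d a] R[of b d a b] by (auto simp: inA ne')
  have ca: "w c a = w c d \<or> w c a = w d a"
    using T[of c a] R[of c a a b] R[of c a b c] by (auto simp: inA ne')
  have db: "w d b = w d a \<or> w d b = w a b"
    using T[of d b] R[of d b b c] R[of d b c d] by (auto simp: inA ne')
  have ba: "w b a = w a b \<or> w b a = w b c \<or> w b a = w d a"
    using T[of b a] R[of b a c d] by (auto simp: inA ne')
  have cb: "w c b = w b c \<or> w c b = w c d \<or> w c b = w a b"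
    using T[of c b] R[of c b d a] by (auto simp: inA ne')
  have dc: "w d c = w c d \<or> w d c = w d a \<or> w d c = w b c"
    using T[of d c] R[of d c a b] by (auto simp: inA ne')
  have ad: "w a d = w d a \<or> w a d = w a b \<or> w a d = w c d"
    using T[of a d] R[of a d b c] by (auto simp: inA ne')
  note R' = R[of b a a c] R[of b a d b] R[of c b b d] R[of c b a c] R[of d c c a] R[of d c b d]
    R[of a d d b] R[of a d c a]
  from ac show ?thesis
  proof
    \<comment> \<open>Here the choice propagates to stars centered at the first index; in the other
      case, at the second.\<close>
    assume 1: "w a c = w a b"
    have 2: "w d b = w d a" using db 1 R[of d b a c] by (auto simp: inA ne')
    have 3: "w c a = w c d" using ca 2 R[of c a d b] by (auto simp: inA ne')
    have 4: "w b d = w b c" using bd 3 R[of b d c a] by (auto simp: inA ne')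
    have "w b a = w b c" "w c b = w c d" "w d c = w d a" "w a d = w a b"
      using R' ba cb dc ad 1 2 3 4 by (auto simp: inA ne')
    then show ?thesis using 1 2 3 4 by (simp add: A)
  next
    assume 1: "w a c = w b c"
    have 2: "w b d = w c d" using bd 1 R[of b d a c] by (auto simp: inA ne')
    have 3: "w c a = w d a" using ca 2 R[of c a b d] by (auto simp: inA ne')
    have 4: "w d b = w a b" using db 3 R[of d b c a] by (auto simp: inA ne')
    have "w b a = w d a" "w c b = w a b" "w d c = w b c" "w a d = w c d"
      using R' ba cb dc ad 1 2 3 4 by (auto simp: inA ne')
    then show ?thesis using 1 2 3 4 by (simp add: A)
  qed
qed

text \<open>In the coordinates of \<open>cube_adj_antipode\<close>, stars at the first index are
  centered in the class \<open>A\<close>, and stars at the second index in the class of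
  antipodes.\<close>

lemma rigid_four_colors:
  assumes C: "rigid_coloring C" and S: "finite S" "card S \<le> 4" "\<And>x y. cube_adj x y \<Longrightarrow> \<bar>C x y\<bar> \<in> S"
  obtains p where "\<And>x y z. parity x = p \<Longrightarrow> cube_adj x y \<Longrightarrow> cube_adj x z \<Longrightarrow> C x y = C x z"
proof -
  define A where "A = {x. parity x = 0}"
  obtain a b c d where dist: "distinct [a, b, c, d]" and A: "A = {a, b, c, d}"
    using parity_class unfolding A_def by blast
  define w where "w i j = \<bar>C i (antipode j)\<bar>" for i j
  have adj: "cube_adj i (antipode j)" if "i \<in> A" "j \<in> A" "i \<noteq> j" for i j
    using that by (simp add: cube_adj_antipode A_def)
  have eq: "C i (antipode j) = C k (antipode m)"
    if "i \<in> A" "j \<in> A" "k \<in> A" "m \<in> A" "i \<noteq> j" "k \<noteq> m" "w i j = w k m" for i j k m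
    using that adj unfolding w_def A_def by (intro rigid_coloring_abs[OF C]) auto
  have "(\<forall>i\<in>A. \<forall>j\<in>A. \<forall>k\<in>A. i \<noteq> j \<longrightarrow> i \<noteq> k \<longrightarrow> w i j = w i k) \<or>
    (\<forall>i\<in>A. \<forall>j\<in>A. \<forall>k\<in>A. i \<noteq> j \<longrightarrow> i \<noteq> k \<longrightarrow> w j i = w k i)"
  proof (rule four_color_stars[OF dist A _ S(1,2)])
    fix i j assume ij: "i \<in> A" "j \<in> A" "i \<noteq> j"
    show "w i j \<in> S" unfolding w_def using S(3) adj[OF ij] by blast
    fix k m assume km: "k \<in> A" "m \<in> A" "k \<noteq> m" "w i j = w k m"
    have "C i (antipode j) = C k (antipode m)" using eq ij km by blast
    then show "i = k \<or> j = m \<or> k = j \<and> m = i"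
      using rigid_coloringD[OF C adj[OF ij] adj[OF km(1-3)]] by auto
  qed
  then show thesis
  proof
    assume out: "\<forall>i\<in>A. \<forall>j\<in>A. \<forall>k\<in>A. i \<noteq> j \<longrightarrow> i \<noteq> k \<longrightarrow> w i j = w i k"
    show thesis
    proof (rule that)
      fix x y z assume x: "parity x = 0" and y: "cube_adj x y" and z: "cube_adj x z"
      have "x \<in> A" "antipode y \<in> A" "antipode z \<in> A" "x \<noteq> antipode y" "x \<noteq> antipode z"
        using x y z unfolding cube_adj_iff A_def by auto
      moreover from this have "w x (antipode y) = w x (antipode z)" using out by blast
      ultimately have "C x (antipode (antipode y)) = C x (antipode (antipode z))"
        by (intro eq)
      then show "C x y = C x z" by simp
    qed
  next
    assume into: "\<forall>i\<in>A. \<forall>j\<in>A. \<forall>k\<in>A. i \<noteq> j \<longrightarrow> i \<noteq> k \<longrightarrow> w j i = w k i"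
    show thesis
    proof (rule that)
      fix x y z assume x: "parity x = 1" and y: "cube_adj x y" and z: "cube_adj x z"
      define i where "i = antipode x"
      have i: "x = antipode i" "i \<in> A"
        using x by (simp_all add: i_def A_def)
      have yz: "y \<in> A" "z \<in> A" "i \<noteq> y" "i \<noteq> z"
        using x y z unfolding cube_adj_iff A_def i_def by auto
      have "w y i = w z i" using into i(2) yz by blast
      then have "C y (antipode i) = C z (antipode i)"
        using i(2) yz by (intro eq) simp_all
      then show "C x y = C x z"
        using rigid_coloring_antisym[OF C] y z i(1) cube_adj_sym by (metis)
    qed
  qed
qed

text \<open>
  If all vertices of one parity class are monochromatic, three copies of the tile of any vertex of
  the other class and the tiles of its neighbors form a \<open>K\<^sub>3\<^sub>,\<^sub>3\<close>.
\<close>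

lemma monochromatic_class_not_realizes3:
  assumes C: "rigid_coloring C" and P: "\<And>x. cube_tile C x \<in> P"
    and mono: "\<And>x y z. parity x = p \<Longrightarrow> cube_adj x y \<Longrightarrow> cube_adj x z \<Longrightarrow> C x y = C x z"
  shows "\<not> realizes3 P cube"
proof
  assume r3: "realizes3 P cube"
  obtain y where y: "parity y \<noteq> p"
    by (metis parity_antipode_iff(1))
  define N where "N = {x. cube_adj y x}"
  have N: "finite N" "card N = 3" unfolding N_def by (simp_all add: card_cube_nbrs)
  have Np: "parity x = p" if "x \<in> N" for x
    using that y unfolding N_def cube_adj_iff by (auto intro: bit_neq_trans)
  have adj: "cube_adj x y" if "x \<in> N" for x using that cube_adj_sym unfolding N_def by blast
  define s where "s x = C x y" for x
  \<comment> \<open>Each neighbor \<open>x\<close> of \<open>y\<close> is joined to three copies of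
    \<open>y\<close>, directed by the sign of \<open>C x y\<close>. As \<open>x\<close> is
    monochromatic, its three equal arcs give its old tile; each copy of \<open>y\<close> meets every
    neighbor once.\<close>
  define D where "D = \<lparr>verts = Inl ` N \<union> Inr ` {0..<3::nat}, arcs = N \<times> {0..<3},
    tail = (\<lambda>(x, j). if s x > 0 then Inl x else Inr j),
    head = (\<lambda>(x, j). if s x > 0 then Inr j else Inl x)\<rparr>"
  have D_simps [simp]: "verts D = Inl ` N \<union> Inr ` {0..<3}" "arcs D = N \<times> {0..<3}"
    "tail D (x, j) = (if s x > 0 then Inl x else Inr j)"
    "head D (x, j) = (if s x > 0 then Inr j else Inl x)" for x j
    by (simp_all add: D_def)
  define l where "l = (\<lambda>(x, j :: nat). \<bar>s x\<bar>)"
  have s0: "s x \<noteq> 0" if "x \<in> N" for x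
    using rigid_coloring_nonzero[OF C adj[OF that]] by (simp add: s_def)
  have left: "vertex_tile D l (Inl x) = cube_tile C x" if x: "x \<in> N" for x
  proof -
    have "cube_tile C x = image_mset (\<lambda>_. s x) (mset_set {z. cube_adj x z})"
      unfolding cube_tile_def s_def
      using mono[OF Np[OF x] _ adj[OF x]] by (intro image_mset_cong) simp
    also have "\<dots> = replicate_mset 3 (s x)"
      by (simp add: image_mset_const_eq card_cube_nbrs)
    finally have tile: "cube_tile C x = replicate_mset 3 (s x)" .
    have const: "image_mset f (mset_set ({x} \<times> {0..<3::nat})) = replicate_mset 3 t"
      if "\<And>j. f (x, j) = t" for f and t :: int
    proof -
      have "image_mset f (mset_set ({x} \<times> {0..<3::nat})) =
          image_mset (\<lambda>_. t) (mset_set ({x} \<times> {0..<3::nat}))"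
      proof (rule image_mset_cong)
        fix e assume "e \<in># mset_set ({x} \<times> {0..<3::nat})"
        then have "fst e = x" by auto
        then show "f e = t" using that[of "snd e"] by (metis prod.collapse)
      qed
      then show ?thesis by (simp add: image_mset_const_eq card_cartesian_product)
    qed
    show ?thesis
    proof (cases "s x > 0")
      case True
      then have "out_arcs D (Inl x) = {x} \<times> {0..<3}" "in_arcs D (Inl x) = {}"
        using x by (auto simp: out_arcs_def in_arcs_def split: if_splits)
      then show ?thesis unfolding vertex_tile_def tile using True by (simp add: const l_def)
    next
      case False
      then have "out_arcs D (Inl x) = {}" "in_arcs D (Inl x) = {x} \<times> {0..<3}"
        using x by (auto simp: out_arcs_def in_arcs_def split: if_splits)
      then show ?thesis unfolding vertex_tile_def tile using False by (simp add: const l_def)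
    qed
  qed
  have right: "vertex_tile D l (Inr j) = cube_tile C y" if j: "j \<in> {0..<3}" for j
  proof -
    define Np where "Np = {x \<in> N. s x > 0}"
    define Nn where "Nn = {x \<in> N. \<not> s x > 0}"
    have fin: "finite Np" "finite Nn" using N(1) by (auto simp: Np_def Nn_def)
    have un: "Nn \<union> Np = N" "Nn \<inter> Np = {}" by (auto simp: Np_def Nn_def)
    have slice: "mset_set (T \<times> {j}) = image_mset (\<lambda>x. (x, j)) (mset_set T)"
      for T :: "(bit \<times> bit \<times> bit) set"
    proof -
      have "T \<times> {j} = (\<lambda>x. (x, j)) ` T" by auto
      then show ?thesis by (simp add: image_mset_mset_set inj_on_def)
    qed
    have "out_arcs D (Inr j) = Nn \<times> {j}" "in_arcs D (Inr j) = Np \<times> {j}"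
      using j by (auto simp: out_arcs_def in_arcs_def Np_def Nn_def split: if_splits)
    then have "vertex_tile D l (Inr j) =
        image_mset (\<lambda>x. \<bar>s x\<bar>) (mset_set Nn) + image_mset (\<lambda>x. - \<bar>s x\<bar>) (mset_set Np)"
      unfolding vertex_tile_def by (simp add: slice multiset.map_comp comp_def l_def)
    also have "\<dots> = image_mset (C y) (mset_set Nn) + image_mset (C y) (mset_set Np)"
    proof (intro arg_cong2[where f = "(+)"] image_mset_cong)
      fix x assume "x \<in># mset_set Nn"
      then have "x \<in> N" "\<not> s x > 0" using fin by (auto simp: Nn_def)
      then show "\<bar>s x\<bar> = C y x" using rigid_coloring_antisym[OF C adj] by (simp add: s_def)
    next
      fix x assume "x \<in># mset_set Np"
      then have "x \<in> N" "s x > 0" using fin by (auto simp: Np_def)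
      then show "- \<bar>s x\<bar> = C y x" using rigid_coloring_antisym[OF C adj] by (simp add: s_def)
    qed
    also have "\<dots> = image_mset (C y) (mset_set N)"
      unfolding un(1)[symmetric] using fin un(2) by (simp add: mset_set_Union)
    finally show ?thesis unfolding cube_tile_def N_def .
  qed
  have card: "card (verts D) = 6"
    using N by (simp, subst card_Un_disjoint) (auto simp: card_image)
  have "ugraph_iso (underlying D) cube"
  proof (rule realizes3_underlying_iso[OF r3])
    show "finite (verts D)" "finite (arcs D)" using N(1) by auto
    show "verts D \<noteq> {}" by auto
    show "card (verts D) \<le> card (uverts cube)" using card by (simp add: card_cube_verts)
    show "induced_pot D l \<subseteq> P"
    proof -
      have "vertex_tile D l v \<in> P" if "v \<in> verts D" for v
        using that by (cases v) (simp_all add: left right P image_iff)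
      then show ?thesis by (auto simp: induced_pot_def)
    qed
    show "l e > 0" if "e \<in> arcs D" for e using that s0 by (auto simp: l_def)
    show "tail D e \<in> verts D \<and> head D e \<in> verts D" if "e \<in> arcs D" for e using that by auto
  qed
  then show False using ugraph_iso_card_verts card by (fastforce simp: card_cube_verts)
qed

lemma realizes3_cube_card_colors:
  assumes "realizes3 P cube" "finite (pot_colors P)"
  shows "5 \<le> card (pot_colors P)"
proof (rule ccontr)
  assume "\<not> ?thesis"
  then have few: "card (pot_colors P) \<le> 4" by simp
  obtain C where C: "rigid_coloring C" "\<And>x. cube_tile C x \<in> P"
    using realizes3_cube_rigid[OF assms(1)] by metis
  have mem: "C x y \<in># cube_tile C x" if "cube_adj x y" for x y
    using that by (simp add: set_cube_tile)
  have "\<bar>C x y\<bar> \<in> pot_colors P" if adj: "cube_adj x y" for x y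
  proof (cases "C x y > 0")
    case True
    then show ?thesis using C(2)[of x] mem[OF adj] by (auto simp: pot_colors_def)
  next
    case False
    \<comment> \<open>\<open>pot_colors\<close> records positive entries only; a negative value is
      seen positively from the other end.\<close>
    then have "C y x > 0" "C y x = \<bar>C x y\<bar>"
      using rigid_coloring_nonzero[OF C(1) adj] rigid_coloring_antisym[OF C(1) adj] by auto
    moreover have "C y x \<in># cube_tile C y" using adj cube_adj_sym by (intro mem) blast
    ultimately show ?thesis using C(2)[of y] by (auto simp: pot_colors_def)
  qed
  then obtain p where "\<And>x y z. parity x = p \<Longrightarrow> cube_adj x y \<Longrightarrow> cube_adj x z \<Longrightarrow> C x y = C x z"
    using rigid_four_colors[OF C(1) assms(2) few] by blast
  then show False
    using monochromatic_class_not_realizes3[OF C] assms(1) by blast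
qed

section \<open>The six-tile pot\<close>

abbreviation (input) cube_pot :: pot where
  "cube_pot \<equiv>
    {{#1, 1, 1#}, {#2, 2, 2#}, {#-2, -3, -3#}, {#-1, -4, -4#}, {#-1, 3, -5#}, {#-2, 4, 5#}}"

text \<open>Triples of tail, head and color. Colors 1 to 4 form stars at (0,0,0), (1,1,1), (0,1,1)
  and (1,0,0); color 5 is an antipodal pair.\<close>

definition cube_arcs :: "((bit \<times> bit \<times> bit) \<times> (bit \<times> bit \<times> bit) \<times> int) set" where
  "cube_arcs =
    {((0, 0, 0), (1, 0, 0), 1), ((0, 0, 0), (0, 0, 1), 1), ((0, 0, 0), (0, 1, 0), 1),
     ((1, 1, 1), (0, 1, 1), 2), ((1, 1, 1), (1, 0, 1), 2), ((1, 1, 1), (1, 1, 0), 2),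
     ((0, 0, 1), (0, 1, 1), 3), ((0, 1, 0), (0, 1, 1), 3),
     ((1, 0, 1), (1, 0, 0), 4), ((1, 1, 0), (1, 0, 0), 4),
     ((1, 0, 1), (0, 0, 1), 5), ((1, 1, 0), (0, 1, 0), 5)}"

section \<open>Realization of the cube by the pot\<close>

lemma cube_verts_UNIV:
  "(UNIV :: (bit \<times> bit \<times> bit) set) =
    {(0, 0, 0), (1, 1, 1), (0, 1, 1), (1, 0, 0), (0, 0, 1), (0, 1, 0), (1, 0, 1), (1, 1, 0)}"
    (is "_ = ?A")
proof -
  have "\<forall>x. x \<in> ?A"
    unfolding split_paired_All by (simp add: bit_forall)
  then show ?thesis by blast
qed

lemma cube_adj_arcs: "cube_adj x y \<longleftrightarrow> (\<exists>k. (x, y, k) \<in> cube_arcs \<or> (y, x, k) \<in> cube_arcs)"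
proof -
  have "\<forall>x y. cube_adj x y \<longleftrightarrow> (\<exists>k. (x, y, k) \<in> cube_arcs \<or> (y, x, k) \<in> cube_arcs)"
    unfolding split_paired_All by (simp add: bit_forall cube_adj_def cube_arcs_def)
  then show ?thesis by blast
qed

lemma cube_uedges_arcs: "uedges cube = (\<lambda>(x, y, k). Upair x y) ` cube_arcs"
proof (intro set_eqI iffI)
  fix e assume "e \<in> uedges cube"
  then obtain x y where e: "e = Upair x y" "cube_adj x y" unfolding cube_uedges by blast
  then obtain k where "(x, y, k) \<in> cube_arcs \<or> (y, x, k) \<in> cube_arcs"
    unfolding cube_adj_arcs by blast
  moreover have "e = Upair y x" using e by simp
  ultimately show "e \<in> (\<lambda>(x, y, k). Upair x y) ` cube_arcs" using e by force
next
  fix e assume "e \<in> (\<lambda>(x, y, k). Upair x y) ` cube_arcs"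
  then obtain z where z: "z \<in> cube_arcs" "e = (case z of (x, y, k) \<Rightarrow> Upair x y)" by blast
  obtain x y k where "z = (x, y, k)" by (rule prod_cases3)
  then show "e \<in> uedges cube" using z cube_adj_arcs[of x y] by auto
qed

lemma card_cube_uedges: "card (uedges cube) = 12"
  unfolding cube_uedges_arcs cube_arcs_def by simp

lemma ugraph_iso_cubeI:
  assumes F: "bij_betw F UNIV (uverts G)"
    and edges: "\<And>x y k. (x, y, k) \<in> cube_arcs \<Longrightarrow> \<exists>e\<in>uedges G. uends G e = Upair (F x) (F y)"
    and fin: "finite (uedges G)" and card: "card (uedges G) = 12"
  shows "ugraph_iso G cube"
proof -
  define g where "g e = map_uprod (inv F) (uends G e)" for e
  have F_inv: "inv F (F x) = x" for x using F by (simp add: bij_betw_def)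
  have sub: "uedges cube \<subseteq> g ` uedges G"
  proof
    fix d assume "d \<in> uedges cube"
    then obtain z where z: "z \<in> cube_arcs" "d = (case z of (x, y, k) \<Rightarrow> Upair x y)"
      unfolding cube_uedges_arcs by blast
    obtain x y k where "z = (x, y, k)" by (rule prod_cases3)
    then have d: "d = Upair x y" "(x, y, k) \<in> cube_arcs" using z by simp_all
    obtain e where "e \<in> uedges G" "uends G e = Upair (F x) (F y)" using edges[OF d(2)] by blast
    then show "d \<in> g ` uedges G" using d(1) by (auto simp: g_def F_inv intro!: image_eqI)
  qed
  have le: "card (g ` uedges G) \<le> 12" using card_image_le[OF fin, of g] card by simp
  then have eq: "uedges cube = g ` uedges G"
    using sub fin by (intro card_seteq) (simp_all add: card_cube_uedges)
  then have "inj_on g (uedges G)"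
    using card fin card_cube_uedges by (intro eq_card_imp_inj_on) simp_all
  then have "bij_betw g (uedges G) (uedges cube)" using eq by (simp add: bij_betw_def)
  moreover have "bij_betw (inv F) (uverts G) (uverts cube)"
    using bij_betw_inv_into[OF F] by simp
  ultimately show ?thesis
    unfolding ugraph_iso_def using g_def by auto
qed

text \<open>Two vertices of one class have a common neighbor, the antipode of a third
  member.\<close>

lemma cube_connected: "(x, y) \<in> {(x, y). cube_adj x y}\<^sup>*"
proof -
  let ?R = "{(x, y). cube_adj x y}"
  have same: "(x, y) \<in> ?R\<^sup>*" if xy: "parity x = parity y" "x \<noteq> y" for x y
  proof -
    obtain c d where c: "distinct [x, y, c, d]" "{v. parity v = parity x} = {x, y, c, d}"
      using parity_class_two[OF xy] by metis
    then have "parity c = parity x" by auto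
    then have "cube_adj x (antipode c)" "cube_adj y (antipode c)"
      using c(1) xy(1) by (auto simp: cube_adj_antipode)
    then have "(x, antipode c) \<in> ?R" "(antipode c, y) \<in> ?R" using cube_adj_sym by auto
    then show ?thesis by (meson r_into_rtrancl rtrancl_trans)
  qed
  obtain z where z: "cube_adj x z"
    using card_cube_nbrs[of x] by (metis card.empty empty_Collect_eq zero_neq_numeral)
  show ?thesis
  proof (cases "parity x = parity y")
    case True
    then show ?thesis using same by (cases "x = y") auto
  next
    case False
    then have "parity z = parity y" using z unfolding cube_adj_iff by (metis bit_neq_trans)
    then have "(z, y) \<in> ?R\<^sup>*" using same by (cases "z = y") auto
    moreover have "(x, z) \<in> ?R" using z by simp
    ultimately show ?thesis by (rule converse_rtrancl_into_rtrancl[rotated])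
  qed
qed

lemma realizes_cube: "realizes cube_pot cube"
proof -
  \<comment> \<open>The triples themselves serve as arcs; the isomorphism at the end changes the
    edge type to that of \<open>cube\<close>.\<close>
  define D where "D = \<lparr>verts = UNIV, arcs = cube_arcs, tail = fst, head = fst \<circ> snd\<rparr>"
  define l where "l = (\<lambda>e :: (bit \<times> bit \<times> bit) \<times> (bit \<times> bit \<times> bit) \<times> int. snd (snd e))"
  have D_simps [simp]: "verts D = UNIV" "arcs D = cube_arcs" "tail D = fst" "head D = fst \<circ> snd"
    by (simp_all add: D_def)
  have fin: "finite cube_arcs" by (simp add: cube_arcs_def)
  have "{(x, y). cube_adj x y} \<subseteq> uadj (underlying D)"
  proof (clarify, unfold cube_adj_arcs)
    fix x y assume "\<exists>k. (x, y, k) \<in> cube_arcs \<or> (y, x, k) \<in> cube_arcs"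
    then show "(x, y) \<in> uadj (underlying D)" by (force simp: uadj_def)
  qed
  then have "uconnected (underlying D)"
    unfolding uconnected_def using cube_connected rtrancl_mono by blast
  then have "ugraph (underlying D)"
    using fin finite_cube_verts by (simp add: ugraph_def)
  moreover have "vertex_tile D l x \<in> cube_pot" for x
  proof -
    have arcs: "mset_set cube_arcs =
        {#((0, 0, 0), (1, 0, 0), 1), ((0, 0, 0), (0, 0, 1), 1), ((0, 0, 0), (0, 1, 0), 1),
          ((1, 1, 1), (0, 1, 1), 2), ((1, 1, 1), (1, 0, 1), 2), ((1, 1, 1), (1, 1, 0), 2),
          ((0, 0, 1), (0, 1, 1), 3), ((0, 1, 0), (0, 1, 1), 3),
          ((1, 0, 1), (1, 0, 0), 4), ((1, 1, 0), (1, 0, 0), 4),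
          ((1, 0, 1), (0, 0, 1), 5), ((1, 1, 0), (0, 1, 0), 5)#}"
      by (simp add: cube_arcs_def)
    have tile: "vertex_tile D l x =
        image_mset l (filter_mset (\<lambda>e. fst e = x) (mset_set cube_arcs)) +
        image_mset (\<lambda>e. - l e) (filter_mset (\<lambda>e. fst (snd e) = x) (mset_set cube_arcs))" for x
      by (simp add: vertex_tile_def out_arcs_def in_arcs_def fin)
    have "\<forall>x. vertex_tile D l x \<in> cube_pot"
      unfolding tile arcs split_paired_All by (simp add: bit_forall l_def add_mset_commute)
    then show ?thesis by blast
  qed
  then have "induced_pot D l \<subseteq> cube_pot" unfolding induced_pot_def by blast
  moreover have "l e > 0" if "e \<in> arcs D" for e
    using that by (auto simp: cube_arcs_def l_def)
  ultimately have "realizes cube_pot (underlying D)" by (intro realizes_underlying)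
  moreover have "ugraph_iso (underlying D) cube"
  proof (rule ugraph_iso_cubeI)
    show "bij_betw id UNIV (uverts (underlying D))" by simp
    show "\<exists>e\<in>uedges (underlying D). uends (underlying D) e = Upair (id x) (id y)"
      if "(x, y, k) \<in> cube_arcs" for x y k
      using that by force
    show "card (uedges (underlying D)) = 12" by (simp add: cube_arcs_def)
  qed (simp add: fin)
  ultimately show ?thesis by (rule realizes_ugraph_iso)
qed

section \<open>Uniqueness of the small graph realized by the pot\<close>

lemma sum_mset_neq: "sum_mset s \<noteq> sum_mset t \<Longrightarrow> (s = t) = False"
  by auto

text \<open>The entries of the tiles sum to 3, 6, -8, -9, -3 and 7, so \<open>sum_mset_neq\<close>
  certifies that the six tiles are distinct.\<close>

lemma sum_cube_pot:
  "(\<Sum>t\<in>cube_pot. f t) = f {#1, 1, 1#} + f {#2, 2, 2#} + f {#-2, -3, -3#} +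
    f {#-1, -4, -4#} + f {#-1, 3, -5#} + (f {#-2, 4, 5#} :: nat)"
  by (simp add: sum_mset_neq)

lemma count_image_mset_set:
  "finite S \<Longrightarrow> count (image_mset f (mset_set S)) k = card {e \<in> S. f e = k}"
proof (induction S rule: finite_induct)
  case (insert x S)
  have "{e \<in> insert x S. f e = k} =
      (if f x = k then insert x {e \<in> S. f e = k} else {e \<in> S. f e = k})"
    by auto
  then show ?case using insert by simp
qed simp

lemma cube_pot_unique:
  assumes H: "realizes cube_pot H" and le: "card (uverts H) \<le> 8"
  shows "ugraph_iso H cube"
proof -
  obtain D c l where D: "is_orientation D H" and c: "edge_coloring c D l"
    and P: "induced_pot D l \<subseteq> cube_pot" and H: "ugraph H"
    using H unfolding realizes_def by blast
  define V where "V = verts D"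
  define t where "t = vertex_tile D l"
  have V_eq: "uverts H = V" and arcs_eq: "uedges H = arcs D"
    and ends: "\<And>e. e \<in> arcs D \<Longrightarrow> uends H e = Upair (tail D e) (head D e)"
    using D by (auto simp: V_def is_orientation_def)
  have fin: "finite V" "finite (arcs D)" and ne: "V \<noteq> {}"
    using H unfolding ugraph_def V_eq arcs_eq by auto
  have in_V: "tail D e \<in> V" "head D e \<in> V" if "e \<in> arcs D" for e
    using H that ends[OF that] unfolding ugraph_def V_eq arcs_eq by force+
  have pos: "l e > 0" if "e \<in> arcs D" for e
    using c that unfolding edge_coloring_def by force
  have tP: "t x \<in> cube_pot" if "x \<in> V" for x
    using P that unfolding induced_pot_def t_def V_def by blast
  have fin_inout: "finite (out_arcs D x)" "finite (in_arcs D x)" for x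
    using fin by (auto simp: out_arcs_def in_arcs_def)
  \<comment> \<open>Colors are positive, so positive entries of a tile count outgoing arcs and
    negative entries incoming ones.\<close>
  have count_out: "count (t x) k = card {e \<in> arcs D. tail D e = x \<and> l e = k}" if "k > 0" for x k
  proof -
    have "{e \<in> in_arcs D x. - l e = k} = {}" using pos that unfolding in_arcs_def by fastforce
    then have "count (t x) k = card {e \<in> out_arcs D x. l e = k}"
      unfolding t_def vertex_tile_def using fin_inout by (simp only: count_union count_image_mset_set) simp
    then show ?thesis by (simp add: out_arcs_def conj_assoc)
  qed
  have count_in: "count (t x) (- k) = card {e \<in> arcs D. head D e = x \<and> l e = k}" if "k > 0" for x k
  proof -
    have "{e \<in> out_arcs D x. l e = - k} = {}" using pos that unfolding out_arcs_def by fastforce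
    then have "count (t x) (- k) = card {e \<in> in_arcs D x. - l e = - k}"
      unfolding t_def vertex_tile_def using fin_inout by (simp only: count_union count_image_mset_set) simp
    then show ?thesis by (simp add: in_arcs_def conj_assoc)
  qed
  have sum_tiles: "(\<Sum>x\<in>V. g (t x)) = (\<Sum>s\<in>cube_pot. card {x \<in> V. t x = s} * g s)"
    for g :: "tile \<Rightarrow> nat"
  proof -
    have "(\<Sum>x\<in>V. g (t x)) = (\<Sum>s\<in>cube_pot. \<Sum>x\<in>{x \<in> V. t x = s}. g (t x))"
      using fin tP by (intro sum.group[symmetric]) auto
    also have "\<dots> = (\<Sum>s\<in>cube_pot. card {x \<in> V. t x = s} * g s)"
      by (intro sum.cong refl) simp
    finally show ?thesis .
  qed
  have fibers: "(\<Sum>x\<in>V. card {e \<in> S. f e = x}) = card S"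
    if "S \<subseteq> arcs D" "\<And>e. e \<in> S \<Longrightarrow> f e \<in> V" for S f
  proof -
    have "finite S" using that(1) fin(2) by (rule finite_subset)
    then show ?thesis
      using sum.group[of S V f "\<lambda>_. 1 :: nat"] fin(1) that(2) by auto
  qed
  \<comment> \<open>Both sides count the arcs of color \<open>k\<close>, by tails and by
    heads.\<close>
  have balance: "(\<Sum>x\<in>V. count (t x) k) = (\<Sum>x\<in>V. count (t x) (- k))" if "k > 0" for k
  proof -
    have comm: "{e \<in> arcs D. f e = x \<and> l e = k} = {e \<in> {e \<in> arcs D. l e = k}. f e = x}"
      for f and x :: 'a by auto
    show ?thesis
      using fibers[of "{e \<in> arcs D. l e = k}" "tail D"] fibers[of "{e \<in> arcs D. l e = k}" "head D"]
        in_V by (simp add: count_out count_in that comm)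
  qed
  define n where "n s = card {x \<in> V. t x = s}" for s
  have "(\<Sum>s\<in>cube_pot. n s * count s k) = (\<Sum>s\<in>cube_pot. n s * count s (- k))" if "k > 0" for k
    using balance[OF that] sum_tiles[of "\<lambda>s. count s k"] sum_tiles[of "\<lambda>s. count s (- k)"]
    unfolding n_def by (simp only:)
  note bal = this[unfolded sum_cube_pot]
  have cardV: "card V = (\<Sum>s\<in>cube_pot. n s)"
    using sum_tiles[of "\<lambda>_. 1"] by (simp only: n_def mult_1_right card_eq_sum)
  define a b c d e f where abcdef: "a = n {#1, 1, 1#}" "b = n {#2, 2, 2#}" "c = n {#-2, -3, -3#}"
    "d = n {#-1, -4, -4#}" "e = n {#-1, 3, -5#}" "f = n {#-2, 4, 5#}"
  \<comment> \<open>The balances of the colors 3, 4, 5, 1 and 2, in this order.\<close>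
  have "e = 2 * c" "f = 2 * d" "f = e" "3 * a = d + e" "3 * b = c + f"
    using bal[of 1] bal[of 2] bal[of 3] bal[of 4] bal[of 5] by (simp_all flip: abcdef)
  then have eqs: "a = c" "b = c" "d = c" "e = 2 * c" "f = 2 * c" by simp_all
  have "card V = 8 * c"
    using cardV eqs unfolding sum_cube_pot abcdef[symmetric] by simp
  moreover have "card V > 0" using fin ne by (simp add: card_gt_0_iff)
  ultimately have "c = 1" using le unfolding V_eq by simp
  then have n: "n {#1, 1, 1#} = 1" "n {#2, 2, 2#} = 1" "n {#-2, -3, -3#} = 1"
      "n {#-1, -4, -4#} = 1" "n {#-1, 3, -5#} = 2" "n {#-2, 4, 5#} = 2"
    using eqs unfolding abcdef by simp_all
  have cardV8: "card V = 8" using cardV n unfolding sum_cube_pot by simp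
  obtain a where a: "{x \<in> V. t x = {#1, 1, 1#}} = {a}"
    using n(1) unfolding n_def by (rule card_1_singletonE)
  obtain b where b: "{x \<in> V. t x = {#2, 2, 2#}} = {b}"
    using n(2) unfolding n_def by (rule card_1_singletonE)
  obtain c where c: "{x \<in> V. t x = {#-2, -3, -3#}} = {c}"
    using n(3) unfolding n_def by (rule card_1_singletonE)
  obtain d where d: "{x \<in> V. t x = {#-1, -4, -4#}} = {d}"
    using n(4) unfolding n_def by (rule card_1_singletonE)
  obtain e1 e2 where e: "{x \<in> V. t x = {#-1, 3, -5#}} = {e1, e2}" "e1 \<noteq> e2"
    using n(5) unfolding n_def card_2_iff by blast
  obtain f1 f2 where f: "{x \<in> V. t x = {#-2, 4, 5#}} = {f1, f2}"
    using n(6) unfolding n_def card_2_iff by blast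
  have ta: "t a = {#1, 1, 1#}" and tb: "t b = {#2, 2, 2#}" and tc: "t c = {#-2, -3, -3#}"
    and td: "t d = {#-1, -4, -4#}" and te: "t e1 = {#-1, 3, -5#}" "t e2 = {#-1, 3, -5#}"
    and tf: "t f1 = {#-2, 4, 5#}" "t f2 = {#-2, 4, 5#}"
    using a b c d e f by blast+
  have V: "V = {a, b, c, d, e1, e2, f1, f2}"
  proof
    show "V \<subseteq> {a, b, c, d, e1, e2, f1, f2}"
    proof
      fix x assume x: "x \<in> V"
      from tP[OF x] show "x \<in> {a, b, c, d, e1, e2, f1, f2}"
        by (elim insertE emptyE) (use x a b c d e(1) f in blast)+
    qed
    show "{a, b, c, d, e1, e2, f1, f2} \<subseteq> V" using a b c d e(1) f by blast
  qed
  have out: "k \<in># t x \<longleftrightarrow> (\<exists>e\<in>arcs D. tail D e = x \<and> l e = k)" if "k > 0" for x k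
  proof -
    have "k \<in># t x \<longleftrightarrow> card {e \<in> arcs D. tail D e = x \<and> l e = k} > 0"
      using count_out[OF that, of x] by (simp flip: count_greater_zero_iff)
    also have "\<dots> \<longleftrightarrow> (\<exists>e\<in>arcs D. tail D e = x \<and> l e = k)"
      using fin(2) by (auto simp: card_gt_0_iff)
    finally show ?thesis .
  qed
  have into: "- k \<in># t x \<longleftrightarrow> (\<exists>e\<in>arcs D. head D e = x \<and> l e = k)" if "k > 0" for x k
  proof -
    have "- k \<in># t x \<longleftrightarrow> card {e \<in> arcs D. head D e = x \<and> l e = k} > 0"
      using count_in[OF that, of x] by (simp flip: count_greater_zero_iff)
    also have "\<dots> \<longleftrightarrow> (\<exists>e\<in>arcs D. head D e = x \<and> l e = k)"
      using fin(2) by (auto simp: card_gt_0_iff)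
    finally show ?thesis .
  qed
  have tail_color: "tail D e \<in> {x \<in> V. l e \<in># t x}" and head_color: "head D e \<in> {x \<in> V. - l e \<in># t x}"
    if "e \<in> arcs D" for e
    using that in_V out[OF pos[OF that]] into[OF pos[OF that]] by blast+
  \<comment> \<open>The tail is unique for colors 1 and 2, the head for colors 3 and 4. This fixes
    all arcs except those of color 5.\<close>
  have col: "{x \<in> V. 1 \<in># t x} = {a}" "{x \<in> V. 2 \<in># t x} = {b}"
    "{x \<in> V. - 3 \<in># t x} = {c}" "{x \<in> V. - 4 \<in># t x} = {d}" "{x \<in> V. 5 \<in># t x} = {f1, f2}"
    unfolding V by (auto simp: ta tb tc td te tf)
  define adj where "adj x y \<longleftrightarrow> (\<exists>e\<in>arcs D. tail D e = x \<and> head D e = y)" for x y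
  have 1: "adj a x" if "- 1 \<in># t x" for x
  proof -
    obtain e where "e \<in> arcs D" "head D e = x" "l e = 1" using into[of 1 x] \<open>- 1 \<in># t x\<close> by auto
    then show ?thesis using tail_color[of e] col(1) unfolding adj_def by auto
  qed
  have 2: "adj b x" if "- 2 \<in># t x" for x
  proof -
    obtain e where "e \<in> arcs D" "head D e = x" "l e = 2" using into[of 2 x] \<open>- 2 \<in># t x\<close> by auto
    then show ?thesis using tail_color[of e] col(2) unfolding adj_def by auto
  qed
  have 3: "adj x c" if "3 \<in># t x" for x
  proof -
    obtain e where "e \<in> arcs D" "tail D e = x" "l e = 3" using out[of 3 x] \<open>3 \<in># t x\<close> by auto
    then show ?thesis using head_color[of e] col(3) unfolding adj_def by auto
  qed
  have 4: "adj x d" if "4 \<in># t x" for x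
  proof -
    obtain e where "e \<in> arcs D" "tail D e = x" "l e = 4" using out[of 4 x] \<open>4 \<in># t x\<close> by auto
    then show ?thesis using head_color[of e] col(4) unfolding adj_def by auto
  qed
  obtain g1 where g1: "g1 \<in> arcs D" "head D g1 = e1" "l g1 = 5" using into[of 5 e1] te by auto
  obtain g2 where g2: "g2 \<in> arcs D" "head D g2 = e2" "l g2 = 5" using into[of 5 e2] te by auto
  have tails: "tail D g1 \<in> {f1, f2}" "tail D g2 \<in> {f1, f2}"
    using tail_color[OF g1(1)] tail_color[OF g2(1)] g1 g2 col(5) by auto
  \<comment> \<open>The tile of \<open>f1\<close> and \<open>f2\<close> contains 5 only once, so two
    arcs of color 5 cannot leave the same vertex.\<close>
  have tails_ne: "tail D g1 \<noteq> tail D g2"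
  proof
    assume same: "tail D g1 = tail D g2"
    have "card {e \<in> arcs D. tail D e = tail D g1 \<and> l e = 5} = 1"
      using count_out[of 5 "tail D g1"] tails(1) tf by auto
    moreover have "{g1, g2} \<subseteq> {e \<in> arcs D. tail D e = tail D g1 \<and> l e = 5}"
      using g1 g2 same by auto
    moreover have "g1 \<noteq> g2" using g1(2) g2(2) e(2) by blast
    ultimately show False using fin(2) card_mono[of "{e \<in> arcs D. tail D e = tail D g1 \<and> l e = 5}" "{g1, g2}"]
      by simp
  qed
  \<comment> \<open>Renumbering \<open>f1\<close> and \<open>f2\<close> by their partners under
    color 5 absorbs the only remaining choice.\<close>
  define h1 h2 where h12: "h1 = tail D g1" "h2 = tail D g2"
  have h: "{h1, h2} = {f1, f2}" using tails tails_ne unfolding h12 by auto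
  have h_adj: "adj h1 e1" "adj h2 e2" using g1 g2 unfolding h12 adj_def by blast+
  have th: "t h1 = {#-2, 4, 5#}" "t h2 = {#-2, 4, 5#}" using tails tf unfolding h12 by auto
  define F :: "bit \<times> bit \<times> bit \<Rightarrow> 'a" where
    "F x = (if x = (0, 0, 0) then a else if x = (1, 1, 1) then b else if x = (0, 1, 1) then c
      else if x = (1, 0, 0) then d else if x = (0, 0, 1) then e1 else if x = (0, 1, 0) then e2
      else if x = (1, 0, 1) then h1 else h2)" for x
  show ?thesis
  proof (rule ugraph_iso_cubeI)
    have "V = {a, b, c, d, e1, e2} \<union> {h1, h2}" unfolding h V by blast
    then have "F ` UNIV = V"
      unfolding cube_verts_UNIV by (simp add: F_def insert_commute)
    moreover from this have "inj F"
      using finite_cube_verts by (intro eq_card_imp_inj_on) (simp_all add: cardV8 card_cube_verts)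
    ultimately show "bij_betw F UNIV (uverts H)" unfolding V_eq by (simp add: bij_betw_def)
    show "finite (uedges H)" using fin by (simp add: arcs_eq)
    \<comment> \<open>Every tile has three entries and every arc contributes two, so there are 8 * 3
      / 2 = 12 arcs.\<close>
    have "(\<Sum>x\<in>V. size (t x)) = (\<Sum>x\<in>V. 3)"
      using tP by (intro sum.cong refl) fastforce
    moreover have "size (t x) = card {e \<in> arcs D. tail D e = x} + card {e \<in> arcs D. head D e = x}" for x
      by (simp add: t_def vertex_tile_def out_arcs_def in_arcs_def)
    ultimately show "card (uedges H) = 12"
      using fibers[of "arcs D" "tail D"] fibers[of "arcs D" "head D"] in_V
      by (simp add: sum.distrib cardV8 arcs_eq)
    fix x y k assume "(x, y, k) \<in> cube_arcs"
    moreover have "\<forall>(x, y, k)\<in>cube_arcs. adj (F x) (F y)"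
      unfolding cube_arcs_def by (simp add: F_def ta tb tc td te th h_adj 1 2 3 4)
    ultimately have "adj (F x) (F y)" by fast
    then show "\<exists>e\<in>uedges H. uends H e = Upair (F x) (F y)"
      unfolding adj_def arcs_eq using ends by metis
  qed
qed

section \<open>The two minima\<close>

lemma realizes3_cube: "realizes3 cube_pot cube"
  unfolding realizes3_def using realizes_cube cube_pot_unique
  by (simp only: cube_simps card_cube_verts) blast

lemma card_cube_pot: "card cube_pot = 6"
  using sum_cube_pot[of "\<lambda>_. 1"] by simp

lemma pot_colors_cube_pot: "pot_colors cube_pot = {1, 2, 3, 4, 5}"
  by (auto simp: pot_colors_def)

theorem proposition1:
  shows "biminimal
    {{#1, 1, 1#}, {#2, 2, 2#}, {#-2, -3, -3#}, {#-1, -4, -4#}, {#-1, 3, -5#}, {#-2, 4, 5#}}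
    cube"
proof -
  have "T3 cube = 6"
    unfolding T3_def
  proof (rule Least_equality)
    show "\<exists>P. realizes3 P cube \<and> finite P \<and> card P = 6"
      using realizes3_cube card_cube_pot by blast
  qed (use realizes3_cube_card in blast)
  moreover have "B3 cube = 5"
    unfolding B3_def
  proof (rule Least_equality)
    have "finite (pot_colors cube_pot)" "card (pot_colors cube_pot) = 5"
      unfolding pot_colors_cube_pot by simp_all
    then show "\<exists>P. realizes3 P cube \<and> finite (pot_colors P) \<and> card (pot_colors P) = 5"
      using realizes3_cube by blast
  qed (use realizes3_cube_card_colors in blast)
  ultimately show ?thesis
    unfolding biminimal_def pot_colors_cube_pot card_cube_pot
    using realizes3_cube by simp
qed

end
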